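(* Let $\alpha$ be the Lamb-Oseen constant, i.e. the unique positive real number with $e^{\alpha}=2\alpha+1$. Let $\{\lambda_n\}_{n\in\mathbb Z}$ be a sequence of complex numbers and $L$ a real number such that $$|\lambda_n-n|\le L<\frac{1}{\pi}\sqrt{\frac{3\alpha}{8}}\qquad\text{for all } n\in\mathbb Z.$$ Then $\{\operatorname{sinc}(\lambda_n-t)\}_{n\in\mathbb Z}$ (functions of $t\in\mathbb R$) satisfies the Paley-Wiener criterion with respect to $\{\operatorname{sinc}(n-t)\}_{n\in\mathbb Z}$, and so forms a Riesz basis for $PW_\pi$.
   Context: For $z\in\mathbb C$, $\operatorname{sinc}(z)=\frac{\sin(\pi z)}{\pi z}$ if $z\neq 0$ and $\operatorname{sinc}(0)=1$. The Fourier transform is $\mathcal F(f)(\xi)=\int_{-\infty}^{\infty} f(t)e^{-i\xi t}\,dt$. The Paley-Wiener space is $PW_\pi=\{f\in L^2(\mathbb R): \operatorname{supp}\mathcal F(f)\subseteq[-\pi,\pi]\}$, a closed subspace of the complex Hilbert space $L^2(\mathbb R)$. A sequence $\{y_n\}$ satisfies the Paley-Wiener criterion with respect to a basis $\{x_n\}$ if there is a constant $0\le\lambda<1$ such that $\left\|\sum_{n} a_n(x_n-y_n)\right\|\le\lambda\left\|\sum_n a_n x_n\right\|$ for all finite families of complex scalars $(a_n)$. A Riesz basis of a Hilbert space $H$ is a sequence that is the image of an orthonormal basis of $H$ under a bounded invertible linear operator on $H$. The Lamb-Oseen constant equals $\alpha=-\frac12-W_{-1}\left(-\frac12 e^{-1/2}\right)=1.25643\ldots$,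 where $W_{-1}$ is the inverse of $\xi\mapsto\xi e^{\xi}$ restricted to $(-\infty,-1]$. *)

theory Defs
  imports "HOL-Probability.Sinc_Integral"
begin

section \<open>The Lamb-Oseen constant\<close>

definition lamb_oseen :: real
  where "lamb_oseen = (THE a. 0 < a \<and> exp a = 2 * a + 1)"

lemma lamb_oseen_ex1: "\<exists>!a::real. 0 < a \<and> exp a = 2 * a + 1"
proof (rule ex_ex1I)
  define f where "f = (\<lambda>x::real. exp x - 2 * x - 1)"
  have cont: "continuous_on S f" for S
    unfolding f_def by (intro continuous_intros)
  have der: "(f has_derivative (\<lambda>v. (exp x - 2) * v)) (at x)" for x
  proof -
    have "(f has_real_derivative (exp x - 2)) (at x)"
      unfolding f_def by (auto intro!: derivative_eq_intros)
    then show ?thesis by (simp add: has_field_derivative_def)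
  qed
  have f1: "f 1 \<le> 0"
    using exp_le by (simp add: f_def)
  have "(1 + 1 + 1 / 2 :: real) \<le> exp 1"
    using exp_lower_Taylor_quadratic[of 1] by simp
  then have "(5 / 2) * (5 / 2) \<le> exp 1 * exp (1 :: real)"
    by (intro mult_mono) auto
  then have f2: "0 \<le> f 2"
    by (simp add: f_def flip: exp_add)
  show "\<exists>a::real. 0 < a \<and> exp a = 2 * a + 1"
  proof -
    obtain x where "1 \<le> x" "x \<le> 2" "f x = 0"
      using IVT'[of f 1 0 2, OF f1 f2 _ cont] by auto
    then show ?thesis
      by (intro exI[of _ x]) (simp add: f_def)
  qed
  have *: False if ab: "0 < a" "a < b" "exp a = 2 * a + 1" "exp b = 2 * b + 1" for a b :: real
  proof -
    have "f 0 = f a" "f a = f b" using ab(3,4) by (simp_all add: f_def)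
    obtain x where x: "0 < x" "x < a" "(\<lambda>v. (exp x - 2) * v) = (\<lambda>v. 0)"
      using Rolle_deriv[OF \<open>0 < a\<close> \<open>f 0 = f a\<close> cont der] by blast
    obtain y where y: "a < y" "y < b" "(\<lambda>v. (exp y - 2) * v) = (\<lambda>v. 0)"
      using Rolle_deriv[OF \<open>a < b\<close> \<open>f a = f b\<close> cont der] by blast
    have "exp x = 2" "exp y = 2"
      using fun_cong[OF x(3), of 1] fun_cong[OF y(3), of 1] by auto
    then have "x = y" by (metis exp_inj_iff)
    then show False using x y by simp
  qed
  show "a = b" if "0 < a \<and> exp a = 2 * a + 1" "0 < b \<and> exp b = 2 * b + 1" for a b :: real
    using *[of a b] *[of b a] that by (cases a b rule: linorder_cases) blast+
qed


section \<open>The complex Hilbert space of square-integrable functions on the real line\<close>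

text \<open>Every Lebesgue measurable function agrees almost everywhere with a Borel one, so Borel
  representatives give all of \<open>L\<^sup>2\<close>.\<close>

definition square_integrable :: "(real \<Rightarrow> complex) \<Rightarrow> bool"
  where "square_integrable f \<longleftrightarrow>
    f \<in> borel_measurable lborel \<and> integrable lborel (\<lambda>x. (cmod (f x))\<^sup>2)"

lemma square_integrable_mult_cnj:
  assumes "square_integrable f" "square_integrable g"
  shows "integrable lborel (\<lambda>x. f x * cnj (g x))"
proof (rule Bochner_Integration.integrable_bound)
  show "integrable lborel (\<lambda>x. (cmod (f x))\<^sup>2 + (cmod (g x))\<^sup>2)"
    using assms by (simp add: square_integrable_def)
  have [measurable]: "f \<in> borel_measurable lborel" "g \<in> borel_measurable lborel"
    using assms by (simp_all add: square_integrable_def)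
  show "(\<lambda>x. f x * cnj (g x)) \<in> borel_measurable lborel"
    by (measurable, intro borel_measurable_continuous_on[where f = cnj] continuous_intros) measurable
  have "cmod (f x * cnj (g x)) \<le> (cmod (f x))\<^sup>2 + (cmod (g x))\<^sup>2" for x
  proof -
    have "2 * (cmod (f x) * cmod (g x)) \<le> (cmod (f x))\<^sup>2 + (cmod (g x))\<^sup>2"
      using sum_squares_bound[of "cmod (f x)" "cmod (g x)"] by (simp only: mult.assoc)
    moreover have "0 \<le> cmod (f x) * cmod (g x)" by simp
    ultimately show ?thesis unfolding norm_mult complex_mod_cnj by linarith
  qed
  then show "AE x in lborel. norm (f x * cnj (g x)) \<le> norm ((cmod (f x))\<^sup>2 + (cmod (g x))\<^sup>2)"
    by simp
qed

lemma square_integrable_0: "square_integrable (\<lambda>x. 0)"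
  by (simp add: square_integrable_def)

lemma square_integrable_scale:
  "square_integrable f \<Longrightarrow> square_integrable (\<lambda>x. c * f x)"
  unfolding square_integrable_def norm_mult power_mult_distrib
  by (auto intro: borel_measurable_times)

lemma square_integrable_add:
  assumes "square_integrable f" "square_integrable g"
  shows "square_integrable (\<lambda>x. f x + g x)"
  unfolding square_integrable_def
proof
  have [measurable]: "f \<in> borel_measurable lborel" "g \<in> borel_measurable lborel"
    using assms by (simp_all add: square_integrable_def)
  show "(\<lambda>x. f x + g x) \<in> borel_measurable lborel" by measurable
  show "integrable lborel (\<lambda>x. (cmod (f x + g x))\<^sup>2)"
  proof (rule Bochner_Integration.integrable_bound)
    show "integrable lborel (\<lambda>x. 2 * (cmod (f x))\<^sup>2 + 2 * (cmod (g x))\<^sup>2)"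
      using assms by (simp add: square_integrable_def)
    have "(cmod (f x + g x))\<^sup>2 \<le> 2 * (cmod (f x))\<^sup>2 + 2 * (cmod (g x))\<^sup>2" for x
    proof -
      have "(cmod (f x + g x))\<^sup>2 \<le> (cmod (f x) + cmod (g x))\<^sup>2"
        by (intro power_mono norm_triangle_ineq) auto
      also have "\<dots> \<le> 2 * (cmod (f x))\<^sup>2 + 2 * (cmod (g x))\<^sup>2"
        using sum_squares_bound[of "cmod (f x)" "cmod (g x)"] unfolding power2_sum by linarith
      finally show ?thesis .
    qed
    then show "AE x in lborel. norm ((cmod (f x + g x))\<^sup>2)
        \<le> norm (2 * (cmod (f x))\<^sup>2 + 2 * (cmod (g x))\<^sup>2)"
      by simp
  qed measurable
qed

lemma square_integrable_uminus: "square_integrable f \<Longrightarrow> square_integrable (\<lambda>x. - f x)"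
  by (simp add: square_integrable_def)

lemma square_integrable_diff:
  "square_integrable f \<Longrightarrow> square_integrable g \<Longrightarrow> square_integrable (\<lambda>x. f x - g x)"
  using square_integrable_add[of f "\<lambda>x. - g x"] square_integrable_uminus[of g] by simp

definition L2_eq :: "(real \<Rightarrow> complex) \<Rightarrow> (real \<Rightarrow> complex) \<Rightarrow> bool"
  where "L2_eq f g \<longleftrightarrow>
    square_integrable f \<and> square_integrable g \<and> (AE x in lborel. f x = g x)"

lemma part_equivp_L2_eq: "part_equivp L2_eq"
proof (rule part_equivpI)
  show "\<exists>f. L2_eq f f"
    using square_integrable_0 by (auto simp: L2_eq_def)
  show "symp L2_eq"
    by (auto intro!: sympI simp: L2_eq_def)
  show "transp L2_eq"
  proof (rule transpI)
    fix f g h assume "L2_eq f g" "L2_eq g h"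
    moreover have "AE x in lborel. f x = h x"
      if "AE x in lborel. f x = g x" "AE x in lborel. g x = h x"
      using that by eventually_elim simp
    ultimately show "L2_eq f h"
      unfolding L2_eq_def by blast
  qed
qed

quotient_type L2 = "real \<Rightarrow> complex" / partial: L2_eq
  by (rule part_equivp_L2_eq)

instantiation L2 :: ab_group_add
begin

lift_definition zero_L2 :: L2 is "\<lambda>x. 0"
  by (simp add: L2_eq_def square_integrable_0)

lift_definition plus_L2 :: "L2 \<Rightarrow> L2 \<Rightarrow> L2" is "\<lambda>f g x. f x + g x"
  unfolding L2_eq_def by (auto simp: square_integrable_add)

lift_definition uminus_L2 :: "L2 \<Rightarrow> L2" is "\<lambda>f x. - f x"
  unfolding L2_eq_def by (auto simp: square_integrable_uminus)

lift_definition minus_L2 :: "L2 \<Rightarrow> L2 \<Rightarrow> L2" is "\<lambda>f g x. f x - g x"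
  unfolding L2_eq_def by (auto simp: square_integrable_diff)

instance
proof
  fix a b c :: L2
  show "a + b + c = a + (b + c)"
    by transfer (auto simp: L2_eq_def square_integrable_add add.assoc)
  show "a + b = b + a"
    by transfer (auto simp: L2_eq_def square_integrable_add add.commute)
  show "0 + a = a"
    by transfer (auto simp: L2_eq_def)
  show "- a + a = 0"
    by transfer (auto simp: L2_eq_def square_integrable_0)
  show "a - b = a + - b"
    by transfer (auto simp: L2_eq_def square_integrable_diff)
qed

end

lift_definition scaleC :: "complex \<Rightarrow> L2 \<Rightarrow> L2" is "\<lambda>c f x. c * f x"
  unfolding L2_eq_def by (auto simp: square_integrable_scale)

lift_definition cinner :: "L2 \<Rightarrow> L2 \<Rightarrow> complex" is "\<lambda>f g. LINT x|lborel. f x * cnj (g x)"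
proof -
  fix f f' g g' assume "L2_eq f f'" "L2_eq g g'"
  then have [measurable]: "f \<in> borel_measurable lborel" "f' \<in> borel_measurable lborel"
      "g \<in> borel_measurable lborel" "g' \<in> borel_measurable lborel"
    and ae: "AE x in lborel. f x = f' x" "AE x in lborel. g x = g' x"
    and int: "integrable lborel (\<lambda>x. f x * cnj (g x))" "integrable lborel (\<lambda>x. f' x * cnj (g' x))"
    by (auto simp: L2_eq_def square_integrable_def[of f] square_integrable_def[of f']
        square_integrable_def[of g] square_integrable_def[of g'] square_integrable_mult_cnj)
  show "(LINT x|lborel. f x * cnj (g x)) = (LINT x|lborel. f' x * cnj (g' x))"
    using ae int by (intro integral_cong_AE) (auto dest: borel_measurable_integrable)
qed

interpretation L2: vector_space scaleC
proof
  fix a b :: complex and x y :: L2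
  show "scaleC a (x + y) = scaleC a x + scaleC a y"
    by transfer (auto simp: L2_eq_def square_integrable_add square_integrable_scale distrib_left)
  show "scaleC (a + b) x = scaleC a x + scaleC b x"
    by transfer (auto simp: L2_eq_def square_integrable_add square_integrable_scale distrib_right)
  show "scaleC a (scaleC b x) = scaleC (a * b) x"
    by transfer (auto simp: L2_eq_def square_integrable_scale mult.assoc)
  show "scaleC 1 x = x"
    by transfer (auto simp: L2_eq_def)
qed

lemma cinner_commute: "cinner f g = cnj (cinner g f)"
  by transfer (simp add: mult.commute flip: Bochner_Integration.integral_cnj)

lemma cinner_add_left: "cinner (f + g) h = cinner f h + cinner g h"
  by transfer (simp add: L2_eq_def distrib_right square_integrable_mult_cnj)

lemma cinner_scaleC_left: "cinner (scaleC c f) g = c * cinner f g"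
  by transfer (simp add: mult.assoc)

lemma cinner_self: "cinner f f = of_real (Re (cinner f f))" "0 \<le> Re (cinner f f)"
  and cinner_self_eq_0: "Re (cinner f f) = 0 \<longleftrightarrow> f = 0"
proof -
  have eq: "(LINT x|lborel. g x * cnj (g x)) = of_real (LINT x|lborel. (cmod (g x))\<^sup>2)"
    for g :: "real \<Rightarrow> complex"
    by (simp only: complex_norm_square[symmetric] integral_complex_of_real)
  show "cinner f f = of_real (Re (cinner f f))" "0 \<le> Re (cinner f f)"
    by (transfer, simp add: eq)+
  show "Re (cinner f f) = 0 \<longleftrightarrow> f = 0"
    by transfer (auto simp: eq L2_eq_def square_integrable_0 square_integrable_def
        integral_nonneg_eq_0_iff_AE)
qed

text \<open>The norm, metric and topology are those induced by \<^const>\<open>cinner\<close>; the real inner product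
  required by the type class is its real part.\<close>

instantiation L2 :: real_inner
begin

definition scaleR_L2 :: "real \<Rightarrow> L2 \<Rightarrow> L2"
  where "scaleR_L2 r = scaleC (of_real r)"

definition inner_L2 :: "L2 \<Rightarrow> L2 \<Rightarrow> real"
  where "inner_L2 f g = Re (cinner f g)"

definition norm_L2 :: "L2 \<Rightarrow> real"
  where "norm_L2 f = sqrt (Re (cinner f f))"

definition dist_L2 :: "L2 \<Rightarrow> L2 \<Rightarrow> real"
  where "dist_L2 f g = norm (f - g)"

definition sgn_L2 :: "L2 \<Rightarrow> L2"
  where "sgn_L2 f = inverse (norm f) *\<^sub>R f"

definition uniformity_L2 :: "(L2 \<times> L2) filter"
  where "uniformity_L2 = (INF e\<in>{0<..}. principal {(f, g). dist f g < e})"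

definition open_L2 :: "L2 set \<Rightarrow> bool"
  where "open_L2 U \<longleftrightarrow> (\<forall>x\<in>U. eventually (\<lambda>(x', y). x' = x \<longrightarrow> y \<in> U) uniformity)"

instance
proof
  fix a b :: real and x y z :: L2
  show "a *\<^sub>R (x + y) = a *\<^sub>R x + a *\<^sub>R y" "(a + b) *\<^sub>R x = a *\<^sub>R x + b *\<^sub>R x"
    "a *\<^sub>R b *\<^sub>R x = (a * b) *\<^sub>R x" "1 *\<^sub>R x = x"
    by (simp_all add: scaleR_L2_def L2.scale_right_distrib L2.scale_left_distrib)
  show "sgn x = inverse (norm x) *\<^sub>R x" "dist x y = norm (x - y)"
    by (simp_all add: sgn_L2_def dist_L2_def)
  show "(uniformity :: (L2 \<times> L2) filter) = (INF e\<in>{0<..}. principal {(f, g). dist f g < e})"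
    by (rule uniformity_L2_def)
  show "open U \<longleftrightarrow> (\<forall>x\<in>U. eventually (\<lambda>(x', y). x' = x \<longrightarrow> y \<in> U) uniformity)" for U :: "L2 set"
    by (rule open_L2_def)
  show "inner x y = inner y x"
    unfolding inner_L2_def by (subst cinner_commute) simp
  show "inner (x + y) z = inner x z + inner y z" "inner (a *\<^sub>R x) y = a * inner x y"
    by (simp_all add: inner_L2_def cinner_add_left cinner_scaleC_left scaleR_L2_def)
  show "0 \<le> inner x x" "inner x x = 0 \<longleftrightarrow> x = 0" "norm x = sqrt (inner x x)"
    by (simp_all add: inner_L2_def cinner_self(2) cinner_self_eq_0 norm_L2_def)
qed

end


section \<open>The Fourier transform and the Paley-Wiener space\<close>

definition fourier_integral :: "(real \<Rightarrow> complex) \<Rightarrow> real \<Rightarrow> complex"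
  where "fourier_integral f \<xi> = (LINT t|lborel. f t * exp (- (\<i> * of_real (\<xi> * t))))"

text \<open>For \<open>f\<close> in \<open>L\<^sup>2\<close> the integral need not converge absolutely. As usual, the transform of \<open>f\<close> is
  the \<open>L\<^sup>2\<close> limit of the transforms of the truncations of \<open>f\<close> to \<open>[-R, R]\<close>. The distance
  is written with the nonnegative integral, which is meaningful without any integrability condition.\<close>

lift_definition has_fourier_transform :: "L2 \<Rightarrow> L2 \<Rightarrow> bool" (infix "has'_fourier'_transform" 50) is
  "\<lambda>f g. ((\<lambda>R. \<integral>\<^sup>+ \<xi>. ennreal ((cmod (fourier_integral (\<lambda>t. indicator {-R..R} t * f t) \<xi> - g \<xi>))\<^sup>2)
            \<partial>lborel) \<longlongrightarrow> 0) at_top"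
proof -
  fix f f' g g' assume fg: "L2_eq f f'" "L2_eq g g'"
  then have [measurable]: "f \<in> borel_measurable lborel" "f' \<in> borel_measurable lborel"
    by (auto simp: L2_eq_def square_integrable_def)
  have ae: "AE t in lborel. f t = f' t" "AE \<xi> in lborel. g \<xi> = g' \<xi>"
    using fg by (auto simp: L2_eq_def)
  have "fourier_integral (\<lambda>t. indicator {-R..R} t * f t)
      = fourier_integral (\<lambda>t. indicator {-R..R} t * f' t)" for R
    unfolding fourier_integral_def
    by (intro ext integral_cong_AE) (use ae in \<open>measurable, auto\<close>)
  moreover have "(\<integral>\<^sup>+ \<xi>. ennreal ((cmod (h \<xi> - g \<xi>))\<^sup>2) \<partial>lborel)
      = (\<integral>\<^sup>+ \<xi>. ennreal ((cmod (h \<xi> - g' \<xi>))\<^sup>2) \<partial>lborel)" for h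
    by (intro nn_integral_cong_AE) (use ae in auto)
  ultimately show "((\<lambda>R. \<integral>\<^sup>+ \<xi>. ennreal ((cmod (fourier_integral (\<lambda>t. indicator {-R..R} t * f t) \<xi> - g \<xi>))\<^sup>2)
            \<partial>lborel) \<longlongrightarrow> 0) at_top =
       ((\<lambda>R. \<integral>\<^sup>+ \<xi>. ennreal ((cmod (fourier_integral (\<lambda>t. indicator {-R..R} t * f' t) \<xi> - g' \<xi>))\<^sup>2)
            \<partial>lborel) \<longlongrightarrow> 0) at_top"
    by simp
qed

text \<open>The support of a class of functions: the complement of the largest open set on which the
  class vanishes almost everywhere.\<close>

lift_definition ess_support :: "L2 \<Rightarrow> real set" is
  "\<lambda>f. {x. \<forall>e>0. \<not> (AE y in lborel. dist y x < e \<longrightarrow> f y = 0)}"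
proof -
  fix f g :: "real \<Rightarrow> complex" assume "L2_eq f g"
  then have "AE x in lborel. f x = g x" by (simp add: L2_eq_def)
  then have "AE y in lborel. (dist y x < e \<longrightarrow> f y = 0) \<longleftrightarrow> (dist y x < e \<longrightarrow> g y = 0)" for x e
    by eventually_elim simp
  then have "(AE y in lborel. dist y x < e \<longrightarrow> f y = 0)
      \<longleftrightarrow> (AE y in lborel. dist y x < e \<longrightarrow> g y = 0)" for x e
    by (rule eventually_subst)
  then show "{x. \<forall>e>0. \<not> (AE y in lborel. dist y x < e \<longrightarrow> f y = 0)}
      = {x. \<forall>e>0. \<not> (AE y in lborel. dist y x < e \<longrightarrow> g y = 0)}"
    by simp
qed

definition paley_wiener_space :: "L2 set"
  where "paley_wiener_space =
    {f. \<exists>g. f has_fourier_transform g \<and> ess_support g \<subseteq> {-pi..pi}}"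


section \<open>The normalized cardinal sine\<close>

text \<open>Unlike \<^const>\<open>Sinc_Integral.sinc\<close>, this one is complex and normalized by \<^const>\<open>pi\<close>.\<close>

definition csinc :: "complex \<Rightarrow> complex"
  where "csinc z = (if z = 0 then 1 else sin (of_real pi * z) / (of_real pi * z))"

lemma isCont_csinc: "isCont csinc z"
proof (cases "z = 0")
  case False
  have "isCont (\<lambda>z. sin (of_real pi * z) / (of_real pi * z)) z"
    using False by (intro continuous_intros) auto
  moreover have "eventually (\<lambda>w. csinc w = sin (of_real pi * w) / (of_real pi * w)) (nhds z)"
    using t1_space_nhds[OF False] by eventually_elim (simp add: csinc_def)
  ultimately show ?thesis by (simp add: isCont_cong)
next
  case True
  have "((\<lambda>z. sin (of_real pi * z)) has_field_derivative of_real pi) (at (0::complex))"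
    by (auto intro!: derivative_eq_intros)
  then have "((\<lambda>z. sin (of_real pi * z) / z) \<longlongrightarrow> of_real pi) (at (0::complex))"
    by (simp add: has_field_derivative_iff)
  then have "((\<lambda>z. (sin (of_real pi * z) / z) / of_real pi) \<longlongrightarrow> of_real pi / of_real pi) (at (0::complex))"
    by (intro tendsto_intros) auto
  then have "((\<lambda>z. sin (of_real pi * z) / (of_real pi * z)) \<longlongrightarrow> 1) (at (0::complex))"
    by (simp add: mult.commute)
  then have "(csinc \<longlongrightarrow> 1) (at 0)"
    by (rule Lim_transform_eventually)
      (auto simp: csinc_def eventually_at_filter)
  then show ?thesis by (simp add: True isCont_def csinc_def)
qed

lemma norm_complex_sin_le: "cmod (sin z) \<le> exp \<bar>Im z\<bar>"
proof -
  have "cmod (sin z) = cmod (exp (\<i> * z) - exp (-(\<i> * z))) / 2"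
    by (simp add: sin_exp_eq norm_divide norm_mult)
  also have "\<dots> \<le> (exp (- Im z) + exp (Im z)) / 2"
    using norm_triangle_ineq4[of "exp (\<i> * z)" "exp (-(\<i> * z))"] by simp
  also have "\<dots> \<le> (exp \<bar>Im z\<bar> + exp \<bar>Im z\<bar>) / 2"
    by (intro divide_right_mono add_mono) auto
  finally show ?thesis by simp
qed

lemma square_integrable_csinc: "square_integrable (\<lambda>t. csinc (w - of_real t))"
proof -
  define h where "h = (\<lambda>t. csinc (w - of_real t))"
  have cont: "continuous_on S h" for S
  proof -
    have "continuous_on UNIV csinc"
      by (intro continuous_at_imp_continuous_on ballI isCont_csinc)
    then show ?thesis
      unfolding h_def by (rule continuous_on_compose2) (auto intro!: continuous_intros)
  qed
  then have [measurable]: "h \<in> borel_measurable borel"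
    by (intro borel_measurable_continuous_onI)
  define k where "k = (\<lambda>t. (cmod (h t))\<^sup>2 * (1 + (t - Re w)\<^sup>2))"
  have "compact (k ` {Re w - 1..Re w + 1})"
    unfolding k_def by (intro compact_continuous_image continuous_intros cont) auto
  then obtain B where B: "\<And>t. t \<in> {Re w - 1..Re w + 1} \<Longrightarrow> k t \<le> B"
    by (meson bdd_above.E bounded_imp_bdd_above compact_imp_bounded imageI)
  define C where "C = max B (2 * (exp (pi * \<bar>Im w\<bar>))\<^sup>2)"
  have k: "k t \<le> C" for t
  proof (cases "t \<in> {Re w - 1..Re w + 1}")
    case True
    then show ?thesis using B by (auto simp: C_def intro: max.coboundedI1)
  next
    case False
    then have d: "1 < \<bar>t - Re w\<bar>" by auto
    have z: "w - of_real t \<noteq> 0" using d by (auto simp: complex_eq_iff)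
    have "cmod (h t) = cmod (sin (of_real pi * (w - of_real t))) / (pi * cmod (w - of_real t))"
      using z by (simp add: h_def csinc_def norm_divide norm_mult)
    also have "\<dots> \<le> exp (pi * \<bar>Im w\<bar>) / \<bar>t - Re w\<bar>"
    proof (rule frac_le)
      show "cmod (sin (of_real pi * (w - of_real t))) \<le> exp (pi * \<bar>Im w\<bar>)"
        using norm_complex_sin_le[of "of_real pi * (w - of_real t)"] by (simp add: abs_mult)
      have "\<bar>t - Re w\<bar> \<le> cmod (w - of_real t)"
        using abs_Re_le_cmod[of "w - of_real t"] by (simp add: abs_minus_commute)
      also have "\<dots> \<le> pi * cmod (w - of_real t)"
        using pi_ge_two by (simp add: mult_le_cancel_right1)
      finally show "\<bar>t - Re w\<bar> \<le> pi * cmod (w - of_real t)" .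
    qed (use d in auto)
    finally have "(cmod (h t))\<^sup>2 \<le> (exp (pi * \<bar>Im w\<bar>) / \<bar>t - Re w\<bar>)\<^sup>2"
      by (intro power_mono) auto
    moreover have "1 \<le> (t - Re w)\<^sup>2"
      using power_mono[of 1 "\<bar>t - Re w\<bar>" 2] d by simp
    ultimately have "k t \<le> (exp (pi * \<bar>Im w\<bar>) / \<bar>t - Re w\<bar>)\<^sup>2 * (2 * (t - Re w)\<^sup>2)"
      unfolding k_def by (intro mult_mono) auto
    also have "\<dots> = 2 * (exp (pi * \<bar>Im w\<bar>))\<^sup>2"
      using d by (simp add: power_divide)
    also have "\<dots> \<le> C" by (simp add: C_def)
    finally show ?thesis .
  qed
  have bound: "(cmod (h t))\<^sup>2 \<le> C * inverse (1 + (t - Re w)\<^sup>2)" for t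
    using k[of t] by (simp add: k_def field_simps add_pos_nonneg)
  have "integrable lborel (\<lambda>x::real. inverse (1 + x\<^sup>2))"
    using integrable_inverse_1_plus_square by (simp add: set_integrable_def einterval_def)
  from lborel_integrable_real_affine[OF this, of 1 "- Re w"]
  have "integrable lborel (\<lambda>t. inverse (1 + (t - Re w)\<^sup>2))"
    by simp
  then have "integrable lborel (\<lambda>t. C * inverse (1 + (t - Re w)\<^sup>2))"
    by (rule integrable_mult_right)
  then have "integrable lborel (\<lambda>t. (cmod (h t))\<^sup>2)"
    by (rule Bochner_Integration.integrable_bound)
      (use bound in \<open>auto intro: order_trans[OF _ abs_ge_self]\<close>)
  then show ?thesis
    by (simp add: square_integrable_def h_def[symmetric])
qed

lift_definition sinc_L2 :: "complex \<Rightarrow> L2" is "\<lambda>w t. csinc (w - of_real t)"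
  by (simp add: L2_eq_def square_integrable_csinc)


section \<open>Riesz bases and the Paley-Wiener criterion\<close>

text \<open>Throughout, \<open>H\<close> is a closed subspace of \<open>L\<^sup>2\<close>, regarded as a Hilbert space in its own right.\<close>

definition bounded_operator_on :: "L2 set \<Rightarrow> (L2 \<Rightarrow> L2) \<Rightarrow> bool"
  where "bounded_operator_on H T \<longleftrightarrow>
    T ` H \<subseteq> H \<and>
    (\<forall>f\<in>H. \<forall>g\<in>H. T (f + g) = T f + T g) \<and>
    (\<forall>c. \<forall>f\<in>H. T (scaleC c f) = scaleC c (T f)) \<and>
    (\<exists>K. \<forall>f\<in>H. norm (T f) \<le> K * norm f)"

definition bounded_invertible_on :: "L2 set \<Rightarrow> (L2 \<Rightarrow> L2) \<Rightarrow> bool"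
  where "bounded_invertible_on H T \<longleftrightarrow>
    bounded_operator_on H T \<and>
    (\<exists>S. bounded_operator_on H S \<and> (\<forall>f\<in>H. S (T f) = f \<and> T (S f) = f))"

definition orthonormal_basis_of :: "L2 set \<Rightarrow> ('i \<Rightarrow> L2) \<Rightarrow> bool"
  where "orthonormal_basis_of H e \<longleftrightarrow>
    range e \<subseteq> H \<and>
    (\<forall>m n. cinner (e m) (e n) = (if m = n then 1 else 0)) \<and>
    H \<subseteq> closure (L2.span (range e))"

definition riesz_basis_of :: "L2 set \<Rightarrow> ('i \<Rightarrow> L2) \<Rightarrow> bool"
  where "riesz_basis_of H x \<longleftrightarrow>
    (\<exists>e T. orthonormal_basis_of H e \<and> bounded_invertible_on H T \<and> (\<forall>n. x n = T (e n)))"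

definition paley_wiener_criterion :: "('i \<Rightarrow> L2) \<Rightarrow> ('i \<Rightarrow> L2) \<Rightarrow> bool"
  where "paley_wiener_criterion x y \<longleftrightarrow>
    (\<exists>l\<ge>0. l < 1 \<and> (\<forall>A a. finite A \<longrightarrow>
      norm (\<Sum>n\<in>A. scaleC (a n) (x n - y n)) \<le> l * norm (\<Sum>n\<in>A. scaleC (a n) (x n))))"

end

theory Submission
  imports Defs
begin

text \<open>The Fourier transform turns the statement into one about exponentials on \<open>[-\<pi>, \<pi>]\<close>: the function
  \<open>sinc (w - t)\<close> is the inverse transform of \<open>e\<^sub>w(\<xi>) = exp (- \<i> w \<xi>)\<close> cut off to \<open>[-\<pi>, \<pi>]\<close>, and the inverse
  transform is \<open>1 / sqrt (2 \<pi>)\<close> times an isometry from \<open>L\<^sup>2[-\<pi>, \<pi>]\<close> onto the Paley-Wiener space. There the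
  perturbation argument of Duffin and Eachus applies. Write \<open>\<delta>\<^sub>n = \<lambda>\<^sub>n - n\<close> and expand the exponential:
  \<open>\<Sum>\<^sub>n a\<^sub>n (e\<^bsub>\<lambda>\<^sub>n\<^esub> - e\<^sub>n) = \<Sum>\<^bsub>k \<ge> 1\<^esub> ((- \<i> \<xi>)\<^sup>k / k!) \<Sum>\<^sub>n a\<^sub>n \<delta>\<^sub>n\<^sup>k e\<^sub>n\<close>.
  Multiplication by \<open>\<xi>\<^sup>k\<close> costs a factor \<open>\<pi>\<^sup>k\<close> on \<open>[-\<pi>, \<pi>]\<close>, and by orthogonality the inner sum has norm at most
  \<open>L\<^sup>k\<close> times that of \<open>\<Sum>\<^sub>n a\<^sub>n e\<^sub>n\<close>. Summing over \<open>k\<close>, the criterion holds with constant \<open>exp (\<pi> L) - 1\<close>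
  (\<open>norm_perturbed_exponentials_le\<close>). This is below \<open>1\<close> as soon as \<open>\<pi> L < ln 2\<close>, and the bound in terms of the
  Lamb-Oseen constant is slightly stronger than that: \<open>sqrt (3 \<alpha> / 8) = 0.686\<dots> < 0.693\<dots> = ln 2\<close>
  (\<open>sqrt_lamb_oseen_less\<close>).

  The criterion gives a Riesz basis by Neumann's argument (\<open>riesz_basis_of_paley_wiener_criterion\<close>): the operator
  \<open>D f = \<Sum>\<^sub>n \<langle>f, x\<^sub>n\<rangle> (x\<^sub>n - y\<^sub>n)\<close> has norm less than \<open>1\<close>, so \<open>T f = f - D f\<close> is invertible, and it sends
  \<open>x\<^sub>n\<close> to \<open>y\<^sub>n\<close>. Here one needs that \<open>L\<^sup>2\<close> is complete (\<open>L2_complete\<close>), that the Paley-Wiener space is a closed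
  subspace, and that the integer translates of sinc form an orthonormal basis of it
  (\<open>orthonormal_basis_sinc\<close>).

  The harmonic analysis rests on one fact, the completeness of the trigonometric system on \<open>[-\<pi>, \<pi>]\<close>
  (\<open>trig_annihilator_AE_zero\<close>), which is derived from the Stone-Weierstrass theorem on the unit circle. It yields
  Parseval's identity. Plancherel's theorem for a function \<open>g\<close> supported in \<open>[-\<pi>, \<pi>]\<close> follows by applying Parseval
  to all modulations of \<open>g\<close>: the sum over \<open>m\<close> of the squared modulus of the transform of \<open>g\<close> at \<open>\<theta> - m\<close> is
  \<open>2 \<pi>\<close> times the squared norm of \<open>g\<close> for every \<open>\<theta>\<close>, and it remains to integrate over \<open>\<theta>\<close> in \<open>[0, 1]\<close>. Rescaling
  covers all bounded supports, which is all that a transform defined by truncations requires.\<close>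


section \<open>The Hilbert space \<open>L\<^sup>2\<close>\<close>

lemma L2_eq_refl [simp]: "L2_eq f f \<longleftrightarrow> square_integrable f"
  by (simp add: L2_eq_def)

lemma square_integrable_rep: "square_integrable (rep_L2 f)"
  using Quotient_rep_reflp[OF Quotient_L2, of f] by simp

lemma abs_rep_L2: "abs_L2 (rep_L2 f) = f"
  by (rule Quotient_abs_rep[OF Quotient_L2])

lemma abs_L2_diff:
  "square_integrable f \<Longrightarrow> square_integrable g \<Longrightarrow> abs_L2 f - abs_L2 g = abs_L2 (\<lambda>x. f x - g x)"
  by (intro minus_L2.abs_eq) auto

lemma integral_mult_cnj_self:
  "(LINT x|lborel. g x * cnj (g x)) = of_real (LINT x|lborel. (cmod (g x))\<^sup>2)"
  by (simp only: complex_norm_square[symmetric] integral_complex_of_real)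

lemma norm_abs_L2: "square_integrable f \<Longrightarrow> (norm (abs_L2 f))\<^sup>2 = (LINT x|lborel. (cmod (f x))\<^sup>2)"
  by (simp add: norm_L2_def cinner.abs_eq integral_mult_cnj_self)

lemma nn_integral_abs_L2:
  assumes "square_integrable f"
  shows "(\<integral>\<^sup>+x. ennreal ((cmod (f x))\<^sup>2) \<partial>lborel) = ennreal ((norm (abs_L2 f))\<^sup>2)"
  unfolding norm_abs_L2[OF assms]
  using assms by (intro nn_integral_eq_integral) (auto simp: square_integrable_def)

lemma square_integrableI_nn_integral:
  assumes "f \<in> borel_measurable lborel" "(\<integral>\<^sup>+x. ennreal ((cmod (f x))\<^sup>2) \<partial>lborel) < \<infinity>"
  shows "square_integrable f"
  unfolding square_integrable_def
  using assms by (auto intro!: integrableI_bounded)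

text \<open>Riesz-Fischer. Along a subsequence with \<open>\<parallel>u\<^bsub>k+1\<^esub> - u\<^sub>k\<parallel> \<le> (1/2)\<^sup>k\<close> representatives converge
  almost everywhere, and Fatou's lemma turns the pointwise limit into a limit in \<open>L\<^sup>2\<close>.\<close>

lemma L2_complete:
  fixes X :: "nat \<Rightarrow> L2"
  assumes "Cauchy X"
  shows "convergent X"
proof -
  have "\<forall>k. \<exists>M. \<forall>m\<ge>M. \<forall>n\<ge>M. dist (X m) (X n) < (1/2)^k"
    using assms unfolding Cauchy_def by simp
  then obtain M where M: "\<And>k m n. m \<ge> M k \<Longrightarrow> n \<ge> M k \<Longrightarrow> dist (X m) (X n) < (1/2)^k"
    by metis
  define r where "r k = (\<Sum>j\<le>k. M j) + k" for k
  have r: "strict_mono r"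
    unfolding strict_mono_Suc_iff r_def by auto
  have rM: "M k \<le> r j" if "k \<le> j" for j k
  proof -
    have "M k \<le> (\<Sum>j\<le>j. M j)"
      using that by (intro member_le_sum) auto
    then show ?thesis by (simp add: r_def)
  qed
  define u where "u k = rep_L2 (X (r k))" for k
  have u: "square_integrable (u k)" "abs_L2 (u k) = X (r k)" for k
    by (simp_all add: u_def square_integrable_rep abs_rep_L2)
  have [measurable]: "u k \<in> borel_measurable borel" for k
    using u(1)[of k] by (simp add: square_integrable_def)
  have dist_u: "(\<integral>\<^sup>+x. ennreal ((cmod (u j x - u k x))\<^sup>2) \<partial>lborel) \<le> ennreal ((1/4)^k)"
    if "k \<le> j" for j k
  proof -
    have "(\<integral>\<^sup>+x. ennreal ((cmod (u j x - u k x))\<^sup>2) \<partial>lborel) = ennreal ((norm (X (r j) - X (r k)))\<^sup>2)"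
      using nn_integral_abs_L2[of "\<lambda>x. u j x - u k x"] abs_L2_diff[of "u j" "u k"] u
      by (simp add: square_integrable_diff)
    also have "norm (X (r j) - X (r k)) \<le> (1/2)^k"
      using M[of k "r j" "r k"] rM[OF that] rM[of k k] by (simp add: dist_norm)
    then have "ennreal ((norm (X (r j) - X (r k)))\<^sup>2) \<le> ennreal (((1/2)^k)\<^sup>2)"
      by (intro ennreal_leI power_mono) auto
    also have "((1/2)^k)\<^sup>2 = ((1/4)^k :: real)"
      by (simp add: power2_eq_square flip: power_mult_distrib)
    finally show ?thesis .
  qed
  \<comment> \<open>The weights \<open>2\<^sup>k\<close> leave room to pass from square summability of the increments to plain summability.\<close>
  have "(\<integral>\<^sup>+x. (\<Sum>k. ennreal (2^k * (cmod (u (Suc k) x - u k x))\<^sup>2)) \<partial>lborel)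
      = (\<Sum>k. \<integral>\<^sup>+x. ennreal (2^k) * ennreal ((cmod (u (Suc k) x - u k x))\<^sup>2) \<partial>lborel)"
    by (subst nn_integral_suminf) (auto simp: ennreal_mult)
  also have "\<dots> = (\<Sum>k. ennreal (2^k) * (\<integral>\<^sup>+x. ennreal ((cmod (u (Suc k) x - u k x))\<^sup>2) \<partial>lborel))"
    by (subst nn_integral_cmult) auto
  also have "\<dots> \<le> (\<Sum>k. ennreal ((1/2)^k))"
  proof (rule suminf_le)
    fix k
    have "ennreal (2^k) * (\<integral>\<^sup>+x. ennreal ((cmod (u (Suc k) x - u k x))\<^sup>2) \<partial>lborel)
        \<le> ennreal (2^k) * ennreal ((1/4)^k)"
      by (intro mult_left_mono dist_u) auto
    also have "\<dots> = ennreal ((1/2)^k)"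
      by (simp flip: ennreal_mult power_mult_distrib)
    finally show "ennreal (2^k) * (\<integral>\<^sup>+x. ennreal ((cmod (u (Suc k) x - u k x))\<^sup>2) \<partial>lborel)
        \<le> ennreal ((1/2)^k)" .
  qed auto
  also have "\<dots> = ennreal (\<Sum>k. (1/2)^k)"
    by (intro suminf_ennreal2 summable_geometric) auto
  also have "\<dots> < \<infinity>" by simp
  finally have fin: "(\<integral>\<^sup>+x. (\<Sum>k. ennreal (2^k * (cmod (u (Suc k) x - u k x))\<^sup>2)) \<partial>lborel) \<noteq> \<infinity>"
    by simp
  have "AE x in lborel. (\<Sum>k. ennreal (2^k * (cmod (u (Suc k) x - u k x))\<^sup>2)) \<noteq> \<infinity>"
    by (rule nn_integral_noteq_infinite[OF _ fin]) measurable
  then have conv: "AE x in lborel. convergent (\<lambda>k. u k x)"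
  proof eventually_elim
    case (elim x)
    define d where "d k = cmod (u (Suc k) x - u k x)" for k
    have "summable (\<lambda>k. 2^k * (d k)\<^sup>2)"
      using elim by (intro summable_suminf_not_top) (auto simp: d_def)
    then have sm: "summable (\<lambda>k. 2^k * (d k)\<^sup>2 + (1/2)^k)"
      by (intro summable_add summable_geometric) auto
    have "d k \<le> 2^k * (d k)\<^sup>2 + (1/2)^k" for k
    proof -
      \<comment> \<open>the arithmetic-geometric mean inequality for \<open>s d\<close> and \<open>1 / s\<close>\<close>
      define s :: real where "s = sqrt (2^k)"
      have s: "s > 0" "s\<^sup>2 = 2^k" by (simp_all add: s_def)
      have "2 * ((s * d k) * (1/s)) \<le> (s * d k)\<^sup>2 + (1/s)\<^sup>2"
        using sum_squares_bound[of "s * d k" "1/s"] by (simp only: mult.assoc)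
      then have "2 * d k \<le> 2^k * (d k)\<^sup>2 + (1/2)^k"
        using s by (simp add: power_mult_distrib power_divide)
      moreover have "0 \<le> d k" by (simp add: d_def)
      ultimately show ?thesis by linarith
    qed
    then have "summable d"
      by (intro summable_comparison_test[OF _ sm]) (auto simp: d_def)
    then have "summable (\<lambda>k. u (Suc k) x - u k x)"
      unfolding d_def by (rule summable_norm_cancel)
    then have "(\<lambda>n. \<Sum>k<n. u (Suc k) x - u k x) \<longlonglongrightarrow> (\<Sum>k. u (Suc k) x - u k x)"
      by (rule summable_LIMSEQ)
    then have "(\<lambda>n. (u n x - u 0 x) + u 0 x) \<longlonglongrightarrow> (\<Sum>k. u (Suc k) x - u k x) + u 0 x"
      by (intro tendsto_add tendsto_const) (simp only: sum_lessThan_telescope[of "\<lambda>k. u k x"])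
    then show ?case by (auto simp: convergent_def)
  qed
  define v where "v x = lim (\<lambda>k. u k x)" for x
  have [measurable]: "v \<in> borel_measurable borel"
    unfolding v_def by measurable
  have dist_v: "(\<integral>\<^sup>+x. ennreal ((cmod (v x - u k x))\<^sup>2) \<partial>lborel) \<le> ennreal ((1/4)^k)" for k
  proof -
    have "(\<integral>\<^sup>+x. ennreal ((cmod (v x - u k x))\<^sup>2) \<partial>lborel)
        = (\<integral>\<^sup>+x. liminf (\<lambda>j. ennreal ((cmod (u j x - u k x))\<^sup>2)) \<partial>lborel)"
    proof (rule nn_integral_cong_AE, use conv in eventually_elim)
      case (elim x)
      then have "(\<lambda>j. u j x) \<longlonglongrightarrow> v x"
        by (simp add: v_def convergent_LIMSEQ_iff)
      then have "(\<lambda>j. ennreal ((cmod (u j x - u k x))\<^sup>2)) \<longlonglongrightarrow> ennreal ((cmod (v x - u k x))\<^sup>2)"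
        by (intro tendsto_ennrealI tendsto_intros)
      then show ?case
        by (rule lim_imp_Liminf[OF trivial_limit_sequentially, symmetric])
    qed
    also have "\<dots> \<le> liminf (\<lambda>j. \<integral>\<^sup>+x. ennreal ((cmod (u j x - u k x))\<^sup>2) \<partial>lborel)"
      by (rule nn_integral_liminf) measurable
    also have "\<dots> \<le> ennreal ((1/4)^k)"
      by (intro Liminf_le eventually_sequentiallyI[of k] dist_u) simp_all
    finally show ?thesis .
  qed
  have vu: "square_integrable (\<lambda>x. v x - u k x)" for k
    using dist_v[of k] by (intro square_integrableI_nn_integral) (auto simp: less_top[symmetric] top_unique)
  have v: "square_integrable v"
    using square_integrable_add[OF vu[of 0] u(1)[of 0]] by simp
  have "norm (X (r k) - abs_L2 v) \<le> (1/2)^k" for k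
  proof -
    have "ennreal ((norm (abs_L2 v - X (r k)))\<^sup>2) \<le> ennreal ((1/4)^k)"
      using nn_integral_abs_L2[OF vu, of k] dist_v[of k] abs_L2_diff[OF v u(1), of k] u(2) by simp
    then have "(norm (abs_L2 v - X (r k)))\<^sup>2 \<le> (1/4)^k"
      by simp
    also have "\<dots> = ((1/2)^k)\<^sup>2"
      by (simp add: power2_eq_square flip: power_mult_distrib)
    finally have "norm (abs_L2 v - X (r k)) \<le> (1/2)^k"
      by (rule power2_le_imp_le) simp
    then show ?thesis by (simp add: norm_minus_commute)
  qed
  then have "(\<lambda>k. X (r k) - abs_L2 v) \<longlonglongrightarrow> 0"
    by (intro Lim_null_comparison[OF always_eventually LIMSEQ_realpow_zero[of "1/2"]]) auto
  then have "(X \<circ> r) \<longlonglongrightarrow> abs_L2 v"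
    by (simp add: LIM_zero_iff o_def)
  then have "X \<longlonglongrightarrow> abs_L2 v"
    using Cauchy_converges_subseq[OF assms r] by simp
  then show ?thesis by (auto simp: convergent_def)
qed

instance L2 :: complete_space
  by standard (rule L2_complete)

instance L2 :: banach ..

lemma cinner_0_left [simp]: "cinner 0 g = 0"
  using cinner_scaleC_left[of 0 g g] by simp

lemma cinner_diff_left: "cinner (f - g) h = cinner f h - cinner g h"
  using cinner_add_left[of "f - g" g h] by simp

lemma cinner_scaleC_right: "cinner f (scaleC c g) = cnj c * cinner f g"
  by (metis cinner_commute cinner_scaleC_left complex_cnj_mult)

lemma cinner_add_right: "cinner f (g + h) = cinner f g + cinner f h"
  by (metis cinner_commute cinner_add_left complex_cnj_add)

lemma cinner_sum_left: "cinner (\<Sum>n\<in>A. f n) g = (\<Sum>n\<in>A. cinner (f n) g)"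
  by (induction A rule: infinite_finite_induct) (simp_all add: cinner_add_left)

lemma cinner_sum_right: "cinner g (\<Sum>n\<in>A. f n) = (\<Sum>n\<in>A. cinner g (f n))"
  by (induction A rule: infinite_finite_induct)
    (simp_all add: cinner_add_right cinner_scaleC_right[of g 0 0, simplified])

lemma cinner_norm: "cinner f f = of_real ((norm f)\<^sup>2)"
  using cinner_self(1,2)[of f] by (simp add: norm_L2_def)

lemma norm_scaleC [simp]: "norm (scaleC c f) = cmod c * norm f"
proof -
  have "cinner (scaleC c f) (scaleC c f) = of_real ((cmod c)\<^sup>2) * cinner f f"
    unfolding cinner_scaleC_left cinner_scaleC_right complex_norm_square by (simp add: mult_ac)
  then have "(of_real ((norm (scaleC c f))\<^sup>2) :: complex) = of_real ((cmod c * norm f)\<^sup>2)"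
    by (simp add: cinner_norm power_mult_distrib)
  then have "(norm (scaleC c f))\<^sup>2 = (cmod c * norm f)\<^sup>2"
    unfolding of_real_eq_iff .
  then show ?thesis by (simp add: power2_eq_iff_nonneg)
qed

lemma cinner_Cauchy_Schwarz: "cmod (cinner f g) \<le> norm f * norm g"
proof (cases "cinner f g = 0")
  case False
  \<comment> \<open>Rotating \<open>f\<close> makes the product real, so the real Cauchy-Schwarz inequality applies.\<close>
  define c where "c = cnj (sgn (cinner f g))"
  define z where "z = cinner f g"
  have "cnj z * z = of_real (cmod z) * of_real (cmod z)"
    using complex_norm_square[of z] by (simp add: mult.commute power2_eq_square)
  then have "c * cinner f g = of_real (cmod (cinner f g))"
    using False by (simp add: c_def sgn_eq flip: z_def)
  then have "cmod (cinner f g) = inner (scaleC c f) g"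
    by (simp add: inner_L2_def cinner_scaleC_left)
  also have "\<dots> \<le> norm (scaleC c f) * norm g"
    by (rule norm_cauchy_schwarz)
  also have "\<dots> = norm f * norm g"
    using False by (simp add: c_def norm_sgn)
  finally show ?thesis .
qed simp

lemma bounded_linear_cinner_left: "bounded_linear (\<lambda>f. cinner f g)"
  by (rule bounded_linear_intro[where K = "norm g"])
    (auto simp: cinner_add_left scaleR_L2_def cinner_scaleC_left cinner_Cauchy_Schwarz
      scaleR_conv_of_real)

lemma norm_diff_sq: "(norm (f - g :: L2))\<^sup>2 = (norm f)\<^sup>2 - 2 * Re (cinner f g) + (norm g)\<^sup>2"
  unfolding power2_norm_eq_inner inner_diff_left inner_diff_right inner_commute[of g f]
  by (simp add: inner_L2_def)

lemma norm_add_sq: "(norm (f + g :: L2))\<^sup>2 = (norm f)\<^sup>2 + 2 * Re (cinner f g) + (norm g)\<^sup>2"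
  unfolding power2_norm_eq_inner inner_add_left inner_add_right inner_commute[of g f]
  by (simp add: inner_L2_def)


text \<open>Cauchy's criterion for unordered sums. It is needed because an orthogonal series in an infinite
  dimensional space can converge without converging absolutely.\<close>

lemma summable_onI_small_tails:
  fixes f :: "'i \<Rightarrow> 'a :: banach"
  assumes "\<And>e. e > 0 \<Longrightarrow> \<exists>F0. finite F0 \<and> (\<forall>F. finite F \<and> F \<inter> F0 = {} \<longrightarrow> norm (sum f F) < e)"
  shows "f summable_on UNIV"
proof -
  have "\<exists>P. eventually P (finite_subsets_at_top UNIV) \<and>
              (\<forall>F F'. P F \<and> P F' \<longrightarrow> dist (sum f F) (sum f F') < e)" if "e > 0" for e
  proof -
    obtain F0 where F0: "finite F0" "\<And>F. finite F \<Longrightarrow> F \<inter> F0 = {} \<Longrightarrow> norm (sum f F) < e / 2"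
      using assms[of "e / 2"] \<open>e > 0\<close> by auto
    have near: "dist (sum f F) (sum f F0) < e / 2" if "finite F" "F0 \<subseteq> F" for F
    proof -
      have "sum f F - sum f F0 = sum f (F - F0)"
        using that by (simp add: sum_diff)
      then show ?thesis
        using F0(2)[of "F - F0"] that by (auto simp: dist_norm)
    qed
    show ?thesis
    proof (intro exI conjI allI impI)
      show "\<forall>\<^sub>F F in finite_subsets_at_top UNIV. finite F \<and> F0 \<subseteq> F"
        unfolding eventually_finite_subsets_at_top using F0(1) by auto
      show "dist (sum f F) (sum f F') < e" if "(finite F \<and> F0 \<subseteq> F) \<and> (finite F' \<and> F0 \<subseteq> F')" for F F'
        using near[of F] near[of F'] that dist_triangle_half_r[of "sum f F0" "sum f F" e "sum f F'"]
        by (simp add: dist_commute)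
    qed
  qed
  then have "cauchy_filter (filtermap (sum f) (finite_subsets_at_top UNIV))"
    by (simp add: cauchy_filter_metric_filtermap)
  moreover have "complete (UNIV :: 'a set)"
    by (simp add: complete_eq_closed)
  ultimately have "\<exists>s. filtermap (sum f) (finite_subsets_at_top UNIV) \<le> nhds s"
    by (rule cauchy_filter_complete_converges) (simp_all add: filtermap_bot_iff)
  then show ?thesis
    unfolding summable_on_def has_sum_def filterlim_def .
qed


section \<open>Orthonormal families\<close>

definition orthonormal :: "('i \<Rightarrow> L2) \<Rightarrow> bool"
  where "orthonormal e \<longleftrightarrow> (\<forall>m n. cinner (e m) (e n) = (if m = n then 1 else 0))"

lemma orthonormal_cinner_sum:
  assumes "orthonormal e" "finite A"
  shows "cinner (\<Sum>n\<in>A. scaleC (a n) (e n)) (e m) = (if m \<in> A then a m else 0)"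
proof -
  have "cinner (\<Sum>n\<in>A. scaleC (a n) (e n)) (e m) = (\<Sum>n\<in>A. if n = m then a n else 0)"
    using assms(1) unfolding cinner_sum_left cinner_scaleC_left orthonormal_def
    by (intro sum.cong) auto
  then show ?thesis using assms(2) by (simp add: sum.delta)
qed

lemma cnj_mult_self_eq_norm: "cnj z * z = of_real ((cmod z)\<^sup>2)"
  using complex_norm_square[of z] by (simp add: mult.commute)

lemma orthonormal_norm_sum:
  assumes "orthonormal e" "finite A"
  shows "(norm (\<Sum>n\<in>A. scaleC (a n) (e n)))\<^sup>2 = (\<Sum>n\<in>A. (cmod (a n))\<^sup>2)"
proof -
  have "cinner (\<Sum>n\<in>A. scaleC (a n) (e n)) (\<Sum>n\<in>A. scaleC (a n) (e n)) = (\<Sum>n\<in>A. cnj (a n) * a n)"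
    by (subst cinner_sum_right) (simp add: cinner_scaleC_right orthonormal_cinner_sum[OF assms])
  also have "\<dots> = of_real (\<Sum>n\<in>A. (cmod (a n))\<^sup>2)"
    by (simp only: cnj_mult_self_eq_norm of_real_sum)
  finally show ?thesis
    unfolding cinner_norm of_real_eq_iff .
qed

lemma Bessel_inequality:
  assumes "orthonormal e" "finite A"
  shows "(\<Sum>n\<in>A. (cmod (cinner f (e n)))\<^sup>2) \<le> (norm f)\<^sup>2"
proof -
  define s where "s = (\<Sum>n\<in>A. scaleC (cinner f (e n)) (e n))"
  have "cinner f s = (\<Sum>n\<in>A. cnj (cinner f (e n)) * cinner f (e n))"
    by (simp add: s_def cinner_sum_right cinner_scaleC_right)
  also have "\<dots> = of_real (\<Sum>n\<in>A. (cmod (cinner f (e n)))\<^sup>2)"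
    by (simp only: cnj_mult_self_eq_norm of_real_sum)
  finally have "Re (cinner f s) = (\<Sum>n\<in>A. (cmod (cinner f (e n)))\<^sup>2)"
    by simp
  moreover have "(norm s)\<^sup>2 = (\<Sum>n\<in>A. (cmod (cinner f (e n)))\<^sup>2)"
    unfolding s_def by (rule orthonormal_norm_sum[OF assms])
  moreover have "0 \<le> (norm (f - s))\<^sup>2" by simp
  ultimately show ?thesis
    unfolding norm_diff_sq by linarith
qed

lemma norm_Fourier_sum_le:
  assumes "orthonormal e" "finite A"
  shows "norm (\<Sum>n\<in>A. scaleC (cinner f (e n)) (e n)) \<le> norm f"
  by (rule power2_le_imp_le) (simp_all add: orthonormal_norm_sum[OF assms] Bessel_inequality[OF assms])

text \<open>The hypothesis of the Paley-Wiener criterion with an arbitrary constant. Taking \<open>z = e\<close> and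
  \<open>l = 1\<close> also covers the Fourier expansion itself, so both series are summed by the same lemma.\<close>

definition dominated_by :: "real \<Rightarrow> ('i \<Rightarrow> L2) \<Rightarrow> ('i \<Rightarrow> L2) \<Rightarrow> bool"
  where "dominated_by l e z \<longleftrightarrow> (\<forall>A a. finite A \<longrightarrow>
    norm (\<Sum>n\<in>A. scaleC (a n) (z n)) \<le> l * norm (\<Sum>n\<in>A. scaleC (a n) (e n)))"

lemma dominated_by_refl: "dominated_by 1 e e"
  by (simp add: dominated_by_def)

text \<open>By Bessel's inequality the squares of the Fourier coefficients are summable, so the tails of the series
  in \<open>e\<close> are small; domination carries this over to \<open>z\<close>.\<close>

lemma dominated_summable:
  assumes e: "orthonormal e" and dom: "dominated_by l e z" and l: "l \<ge> 0"
  shows "(\<lambda>n. scaleC (cinner f (e n)) (z n)) summable_on UNIV"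
proof (rule summable_onI_small_tails)
  fix d :: real assume d: "d > 0"
  define c where "c n = (cmod (cinner f (e n)))\<^sup>2" for n
  \<comment> \<open>The summand \<open>1\<close> keeps the denominator positive when \<open>l = 0\<close>.\<close>
  define \<epsilon> where "\<epsilon> = (d / (l + 1))\<^sup>2"
  have \<epsilon>: "\<epsilon> > 0" using d l by (simp add: \<epsilon>_def)
  have sm: "c summable_on UNIV"
    by (rule nonneg_bdd_above_summable_on)
      (auto simp: c_def bdd_above_def intro!: exI[of _ "(norm f)\<^sup>2"] Bessel_inequality[OF e])
  then obtain F0 where F0: "finite F0" "dist (sum c F0) (infsum c UNIV) \<le> \<epsilon> / 2"
    using infsum_finite_approximation[OF sm, of "\<epsilon> / 2"] \<epsilon> by auto
  have "norm (\<Sum>n\<in>F. scaleC (cinner f (e n)) (z n)) < d" if F: "finite F" "F \<inter> F0 = {}" for F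
  proof -
    have "sum c F + sum c F0 = sum c (F \<union> F0)"
      using F F0(1) by (simp add: sum.union_disjoint)
    also have "\<dots> \<le> infsum c UNIV"
      using F F0(1) by (intro finite_sum_le_infsum sm) (auto simp: c_def)
    finally have "sum c F < \<epsilon>"
      using F0(2) \<epsilon> unfolding dist_real_def by linarith
    then have "(norm (\<Sum>n\<in>F. scaleC (cinner f (e n)) (e n)))\<^sup>2 < (d / (l + 1))\<^sup>2"
      unfolding orthonormal_norm_sum[OF e F(1)] c_def \<epsilon>_def .
    then have *: "norm (\<Sum>n\<in>F. scaleC (cinner f (e n)) (e n)) < d / (l + 1)"
      by (rule power_less_imp_less_base) (use d l in auto)
    have "norm (\<Sum>n\<in>F. scaleC (cinner f (e n)) (z n))
        \<le> l * norm (\<Sum>n\<in>F. scaleC (cinner f (e n)) (e n))"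
      using dom F(1) by (simp add: dominated_by_def)
    also have "\<dots> \<le> l * (d / (l + 1))"
      using * l by (intro mult_left_mono) auto
    also have "\<dots> < d"
      using d l by (simp add: field_simps)
    finally show ?thesis .
  qed
  with F0(1) show "\<exists>F0. finite F0 \<and> (\<forall>F. finite F \<and> F \<inter> F0 = {} \<longrightarrow>
      norm (\<Sum>n\<in>F. scaleC (cinner f (e n)) (z n)) < d)"
    by blast
qed

lemma norm_dominated_infsum_le:
  assumes e: "orthonormal e" and dom: "dominated_by l e z" and l: "l \<ge> 0"
  shows "norm (\<Sum>\<^sub>\<infinity>n. scaleC (cinner f (e n)) (z n)) \<le> l * norm f"
proof (rule Lim_norm_ubound)
  show "((\<lambda>F. \<Sum>n\<in>F. scaleC (cinner f (e n)) (z n)) \<longlongrightarrow> (\<Sum>\<^sub>\<infinity>n. scaleC (cinner f (e n)) (z n)))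
      (finite_subsets_at_top UNIV)"
    using has_sum_infsum[OF dominated_summable[OF assms]] by (simp add: has_sum_def)
  show "\<forall>\<^sub>F F in finite_subsets_at_top UNIV. norm (\<Sum>n\<in>F. scaleC (cinner f (e n)) (z n)) \<le> l * norm f"
  proof (rule eventually_finite_subsets_at_top_weakI)
    fix F :: "'a set" assume F: "finite F"
    then have "norm (\<Sum>n\<in>F. scaleC (cinner f (e n)) (z n))
        \<le> l * norm (\<Sum>n\<in>F. scaleC (cinner f (e n)) (e n))"
      using dom by (simp add: dominated_by_def)
    also have "\<dots> \<le> l * norm f"
      using l norm_Fourier_sum_le[OF e F] by (intro mult_left_mono)
    finally show "norm (\<Sum>n\<in>F. scaleC (cinner f (e n)) (z n)) \<le> l * norm f" .
  qed
qed simp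

text \<open>The Fourier series of \<open>f\<close> has the same coefficients as \<open>f\<close>; their difference is therefore orthogonal to
  the whole family, which is how completeness of the family enters later.\<close>

lemma cinner_Fourier_infsum:
  assumes e: "orthonormal e"
  shows "cinner (\<Sum>\<^sub>\<infinity>n. scaleC (cinner f (e n)) (e n)) (e m) = cinner f (e m)"
proof -
  have "((\<lambda>n. cinner (scaleC (cinner f (e n)) (e n)) (e m))
      has_sum cinner (\<Sum>\<^sub>\<infinity>n. scaleC (cinner f (e n)) (e n)) (e m)) UNIV"
    by (rule has_sum_bounded_linear[OF bounded_linear_cinner_left
        has_sum_infsum[OF dominated_summable[OF e dominated_by_refl]]]) simp
  moreover have "((\<lambda>n. cinner (scaleC (cinner f (e n)) (e n)) (e m)) has_sum cinner f (e m)) UNIV"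
  proof -
    have "((\<lambda>n. cinner (scaleC (cinner f (e n)) (e n)) (e m)) has_sum cinner f (e m)) {m}"
      using e by (intro has_sum_finiteI) (auto simp: cinner_scaleC_left orthonormal_def)
    then show ?thesis
      by (rule has_sum_cong_neutral[THEN iffD1, rotated -1])
        (use e in \<open>auto simp: cinner_scaleC_left orthonormal_def\<close>)
  qed
  ultimately show ?thesis
    by (rule has_sum_unique)
qed

lemma Parseval:
  assumes e: "orthonormal e" and f: "((\<lambda>n. scaleC (cinner f (e n)) (e n)) has_sum f) UNIV"
  shows "((\<lambda>n. (cmod (cinner f (e n)))\<^sup>2) has_sum (norm f)\<^sup>2) UNIV"
proof -
  have "((\<lambda>F. (norm (\<Sum>n\<in>F. scaleC (cinner f (e n)) (e n)))\<^sup>2) \<longlongrightarrow> (norm f)\<^sup>2)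
      (finite_subsets_at_top UNIV)"
    using f unfolding has_sum_def by (intro tendsto_intros)
  then show ?thesis
    unfolding has_sum_def
    by (rule Lim_transform_eventually)
      (auto intro!: eventually_finite_subsets_at_top_weakI simp: orthonormal_norm_sum[OF e])
qed

lemma has_sum_in_closed_subspace:
  assumes "(g has_sum s) UNIV" "L2.subspace H" "closed H" "\<And>n. g n \<in> H"
  shows "s \<in> H"
proof (rule Lim_in_closed_set)
  show "(sum g \<longlongrightarrow> s) (finite_subsets_at_top UNIV)"
    using assms(1) by (simp add: has_sum_def)
  show "\<forall>\<^sub>F F in finite_subsets_at_top UNIV. sum g F \<in> H"
    by (intro eventually_finite_subsets_at_top_weakI L2.subspace_sum assms)
qed (use assms in auto)

lemma bounded_linear_scaleC: "bounded_linear (scaleC c)"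
  by (rule bounded_linear_intro[where K = "cmod c"])
    (auto simp: L2.scale_right_distrib scaleR_L2_def mult.commute)

lemma has_sum_in_closure_span:
  assumes "((\<lambda>n. scaleC (c n) (e n)) has_sum s) UNIV"
  shows "s \<in> closure (L2.span (range e))"
proof (rule Lim_in_closed_set)
  show "((\<lambda>F. \<Sum>n\<in>F. scaleC (c n) (e n)) \<longlongrightarrow> s) (finite_subsets_at_top UNIV)"
    using assms by (simp add: has_sum_def)
  have "(\<Sum>n\<in>F. scaleC (c n) (e n)) \<in> closure (L2.span (range e))" for F
    by (intro subsetD[OF closure_subset] L2.span_sum L2.span_scale L2.span_base rangeI)
  then show "\<forall>\<^sub>F F in finite_subsets_at_top UNIV.
      (\<Sum>n\<in>F. scaleC (c n) (e n)) \<in> closure (L2.span (range e))"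
    by simp
qed auto

text \<open>Neumann's argument: \<open>T = 1 - D\<close> with \<open>D\<close> of norm at most \<open>l < 1\<close>. Instead of summing the series of powers
  of \<open>D\<close>, the equation \<open>T g = f\<close> is solved as the fixed point equation \<open>g = f + D g\<close> of a contraction.\<close>

theorem riesz_basis_of_paley_wiener_criterion:
  assumes H: "L2.subspace H" "closed H" and e: "orthonormal_basis_of H e"
    and y: "\<And>n. y n \<in> H" and pw: "paley_wiener_criterion e y"
  shows "riesz_basis_of H y"
proof -
  have on: "orthonormal e" and eH: "e n \<in> H" for n
    using e by (auto simp: orthonormal_basis_of_def orthonormal_def)
  obtain l where l: "l \<ge> 0" "l < 1" and dom: "dominated_by l e (\<lambda>n. e n - y n)"
    using pw unfolding paley_wiener_criterion_def dominated_by_def by auto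
  define D where "D f = (\<Sum>\<^sub>\<infinity>n. scaleC (cinner f (e n)) (e n - y n))" for f
  have D_sum: "((\<lambda>n. scaleC (cinner f (e n)) (e n - y n)) has_sum D f) UNIV" for f
    unfolding D_def by (intro has_sum_infsum dominated_summable[OF on dom l(1)])
  have D_norm: "norm (D f) \<le> l * norm f" for f
    unfolding D_def by (rule norm_dominated_infsum_le[OF on dom l(1)])
  have D_H: "D f \<in> H" for f
    by (rule has_sum_in_closed_subspace[OF D_sum H])
      (intro L2.subspace_scale L2.subspace_diff H eH y)
  have D_add: "D (f + g) = D f + D g" for f g
  proof (rule has_sum_unique[OF D_sum])
    show "((\<lambda>n. scaleC (cinner (f + g) (e n)) (e n - y n)) has_sum D f + D g) UNIV"
      using has_sum_add[OF D_sum[of f] D_sum[of g]]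
      by (simp add: cinner_add_left L2.scale_left_distrib)
  qed
  have D_scale: "D (scaleC c f) = scaleC c (D f)" for c f
  proof (rule has_sum_unique[OF D_sum])
    show "((\<lambda>n. scaleC (cinner (scaleC c f) (e n)) (e n - y n)) has_sum scaleC c (D f)) UNIV"
      using has_sum_bounded_linear[OF bounded_linear_scaleC[of c] D_sum[of f]]
      by (simp add: cinner_scaleC_left)
  qed
  have D_diff: "D (f - g) = D f - D g" for f g
    using D_add[of "f - g" g] by simp
  have D_e: "D (e m) = e m - y m" for m
  proof (rule has_sum_unique[OF D_sum])
    have "((\<lambda>n. scaleC (cinner (e m) (e n)) (e n - y n)) has_sum (e m - y m)) {m}"
      using on by (intro has_sum_finiteI) (auto simp: orthonormal_def)
    then show "((\<lambda>n. scaleC (cinner (e m) (e n)) (e n - y n)) has_sum (e m - y m)) UNIV"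
      by (rule has_sum_cong_neutral[THEN iffD1, rotated -1]) (use on in \<open>auto simp: orthonormal_def\<close>)
  qed
  define T where "T f = f - D f" for f
  have T_add: "T (f + g) = T f + T g" for f g
    by (simp add: T_def D_add)
  have T_scale: "T (scaleC c f) = scaleC c (T f)" for c f
    by (simp add: T_def D_scale L2.scale_right_diff_distrib)
  have T_norm: "(1 - l) * norm f \<le> norm (T f)" for f
    using norm_triangle_ineq2[of f "D f"] D_norm[of f] by (simp add: T_def algebra_simps)
  have T_bdd: "bounded_operator_on H T"
    unfolding bounded_operator_on_def
  proof (intro conjI ballI allI)
    show "T ` H \<subseteq> H"
      by (auto simp: T_def intro!: L2.subspace_diff H D_H)
    show "\<exists>K. \<forall>f\<in>H. norm (T f) \<le> K * norm f"
    proof (intro exI ballI)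
      show "norm (T f) \<le> (1 + l) * norm f" for f
        using norm_triangle_ineq4[of f "D f"] D_norm[of f] by (simp add: T_def algebra_simps)
    qed
  qed (simp_all add: T_add T_scale)
  have T_ex: "\<exists>!g. T g = f" for f
  proof -
    have "\<exists>!g. f + D g = g"
    proof (rule banach_fix_type[OF l])
      show "\<forall>x y. dist (f + D x) (f + D y) \<le> l * dist x y"
        using D_norm by (simp add: dist_norm flip: D_diff)
    qed
    moreover have "f + D g = g \<longleftrightarrow> T g = f" for g
      by (auto simp: T_def diff_eq_eq)
    ultimately show ?thesis by simp
  qed
  define S where "S f = (THE g. T g = f)" for f
  have TS: "T (S f) = f" for f
    unfolding S_def by (rule theI'[OF T_ex])
  have ST: "S (T f) = f" for f
    unfolding S_def by (rule the1_equality[OF T_ex refl])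
  \<comment> \<open>The fixed point is sought in all of \<open>L\<^sup>2\<close>; it lies in \<open>H\<close> because \<open>D\<close> maps into \<open>H\<close>.\<close>
  have S_H: "S f \<in> H" if "f \<in> H" for f
  proof -
    have "S f = f + D (S f)"
      using TS[of f] by (simp add: T_def algebra_simps)
    also have "\<dots> \<in> H"
      by (intro L2.subspace_add H that D_H)
    finally show ?thesis .
  qed
  have S_bdd: "bounded_operator_on H S"
    unfolding bounded_operator_on_def
  proof (intro conjI ballI allI)
    show "S ` H \<subseteq> H" by (auto simp: S_H)
    show "S (f + g) = S f + S g" for f g
      using ST[of "S f + S g"] by (simp only: T_add TS)
    show "S (scaleC c f) = scaleC c (S f)" for c f
      using ST[of "scaleC c (S f)"] by (simp only: T_scale TS)
    show "\<exists>K. \<forall>f\<in>H. norm (S f) \<le> K * norm f"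
    proof (intro exI ballI)
      show "norm (S f) \<le> 1 / (1 - l) * norm f" for f
        using T_norm[of "S f"] l by (simp add: TS field_simps)
    qed
  qed
  have "bounded_invertible_on H T"
    unfolding bounded_invertible_on_def using T_bdd S_bdd ST TS by blast
  moreover have "y n = T (e n)" for n
    by (simp add: T_def D_e)
  ultimately show ?thesis
    unfolding riesz_basis_of_def using e by blast
qed


section \<open>Uniqueness for Fourier coefficients\<close>

text \<open>The functions whose integrals against all trigonometric monomials vanish. The class is closed under
  multiplication by these monomials, hence by every trigonometric polynomial.\<close>

definition trig_annihilator :: "(real \<Rightarrow> complex) \<Rightarrow> bool"
  where "trig_annihilator g \<longleftrightarrow> integrable lborel g \<and> (\<forall>n::int. (LINT x|lborel. g x * cis (of_int n * x)) = 0)"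

lemma integrable_mult_bounded_continuous:
  fixes f g :: "real \<Rightarrow> complex"
  assumes f: "integrable lborel f" and g: "continuous_on UNIV g" "\<And>x. cmod (g x) \<le> B"
  shows "integrable lborel (\<lambda>x. f x * g x)"
proof (rule Bochner_Integration.integrable_bound)
  show "integrable lborel (\<lambda>x. B * cmod (f x))"
    using f by simp
  have [measurable]: "g \<in> borel_measurable borel" "f \<in> borel_measurable borel"
    using borel_measurable_continuous_onI[OF g(1)] borel_measurable_integrable[OF f] by simp_all
  show "(\<lambda>x. f x * g x) \<in> borel_measurable lborel"
    by measurable
  have "cmod (f x * g x) \<le> B * cmod (f x)" for x
    using mult_right_mono[OF g(2), of "cmod (f x)" x] by (simp add: norm_mult mult.commute)
  then show "AE x in lborel. norm (f x * g x) \<le> norm (B * cmod (f x))"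
    by (auto intro: order_trans[OF _ abs_ge_self])
qed

lemma continuous_on_cis: "continuous_on S g \<Longrightarrow> continuous_on S (\<lambda>x. cis (g x))"
  unfolding cis_conv_exp by (intro continuous_intros)

lemma integrable_mult_cis:
  "integrable lborel f \<Longrightarrow> integrable lborel (\<lambda>x. f x * cis (c * x))"
  by (rule integrable_mult_bounded_continuous[where B = 1])
    (auto intro!: continuous_on_cis continuous_intros)

lemma trig_annihilator_add:
  "trig_annihilator f \<Longrightarrow> trig_annihilator g \<Longrightarrow> trig_annihilator (\<lambda>x. f x + g x)"
  by (simp add: trig_annihilator_def distrib_right integrable_mult_cis)

lemma trig_annihilator_mult_const: "trig_annihilator f \<Longrightarrow> trig_annihilator (\<lambda>x. f x * c)"
proof -
  have "(\<lambda>x. f x * c * cis (d * x)) = (\<lambda>x. c * (f x * cis (d * x)))" for d by (simp add: mult_ac)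
  then show "trig_annihilator f \<Longrightarrow> trig_annihilator (\<lambda>x. f x * c)"
    by (simp only: trig_annihilator_def) (simp add: integrable_mult_cis)
qed

lemma trig_annihilator_mult_cis:
  assumes "trig_annihilator f"
  shows "trig_annihilator (\<lambda>x. f x * cis (of_int m * x))"
proof -
  have "(\<lambda>x. f x * cis (of_int m * x) * cis (of_int n * x)) = (\<lambda>x. f x * cis (of_int (m + n) * x))" for n
    by (simp add: cis_mult distrib_right mult.assoc)
  then show ?thesis
    using assms by (simp only: trig_annihilator_def) (simp add: integrable_mult_cis del: of_int_add)
qed

text \<open>Restricted to the unit circle, a real linear form is a combination of \<open>cis x\<close> and \<open>cis (- x)\<close>; the
  cases of sums and products follow from the closure properties because \<open>f\<close> is arbitrary in the induction.\<close>

lemma trig_annihilator_mult_polynomial: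
  fixes q :: "complex \<Rightarrow> real"
  assumes "real_polynomial_function q" "trig_annihilator f"
  shows "trig_annihilator (\<lambda>x. f x * of_real (q (cis x)))"
  using assms
proof (induction arbitrary: f)
  case (linear q)
  interpret q: bounded_linear q by fact
  define a b where "a = complex_of_real (q 1)" and "b = complex_of_real (q \<i>)"
  have "of_real (q (cis x)) = cis (of_int 1 * x) * ((a - \<i> * b) / 2) + cis (of_int (-1) * x) * ((a + \<i> * b) / 2)"
    for x
  proof -
    have "cis x = cos x *\<^sub>R 1 + sin x *\<^sub>R \<i>"
      by (simp add: complex_eq_iff)
    then have "q (cis x) = cos x * q 1 + sin x * q \<i>"
      by (simp only: q.add q.scaleR real_scaleR_def)
    then have *: "complex_of_real (q (cis x)) = of_real (cos x) * a + of_real (sin x) * b"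
      by (simp add: a_def b_def)
    show ?thesis
      unfolding * by (simp add: a_def b_def complex_eq_iff field_simps)
  qed
  then have "(\<lambda>x. f x * of_real (q (cis x))) = (\<lambda>x. f x * cis (of_int 1 * x) * ((a - \<i> * b) / 2)
      + f x * cis (of_int (-1) * x) * ((a + \<i> * b) / 2))"
    by (simp only: distrib_left mult.assoc)
  then show ?case
    by (simp only:) (intro trig_annihilator_add trig_annihilator_mult_const trig_annihilator_mult_cis linear)
next
  case (const c)
  then show ?case by (intro trig_annihilator_mult_const)
next
  case (add q1 q2)
  then show ?case
    by (simp add: distrib_left trig_annihilator_add)
next
  case (mult q1 q2)
  have "(\<lambda>x. f x * of_real (q1 (cis x) * q2 (cis x)))
      = (\<lambda>x. f x * of_real (q1 (cis x)) * of_real (q2 (cis x)))"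
    by (simp add: mult_ac)
  then show ?case using mult by simp
qed

lemma trig_annihilator_integral_0: "trig_annihilator f \<Longrightarrow> (LINT x|lborel. f x) = 0"
  unfolding trig_annihilator_def by (auto dest!: spec[where x = "0::int"])

text \<open>Polynomials are uniformly dense in the continuous functions on the circle (Stone-Weierstrass), and
  a uniform error is harmless against an integrable function.\<close>

lemma trig_annihilator_continuous:
  fixes h :: "complex \<Rightarrow> real"
  assumes f: "trig_annihilator f" and h: "continuous_on UNIV h"
  shows "(LINT x|lborel. f x * of_real (h (cis x))) = 0"
proof -
  have fi: "integrable lborel f" using f by (simp add: trig_annihilator_def)
  have "compact (h ` sphere 0 1)"
    by (intro compact_continuous_image compact_sphere continuous_on_subset[OF h]) auto
  then obtain B where B: "\<And>z. z \<in> sphere 0 1 \<Longrightarrow> \<bar>h z\<bar> \<le> B"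
    by (metis compact_imp_bounded bounded_iff image_eqI real_norm_def)
  have hi: "integrable lborel (\<lambda>x. f x * of_real (h (cis x)))"
  proof (rule integrable_mult_bounded_continuous[OF fi])
    show "continuous_on UNIV (\<lambda>x. complex_of_real (h (cis x)))"
      by (intro continuous_on_of_real continuous_on_compose2[OF h] continuous_on_cis continuous_intros) auto
    show "cmod (complex_of_real (h (cis x))) \<le> B" for x
      using B[of "cis x"] by simp
  qed
  define K where "K = (LINT x|lborel. cmod (f x))"
  have K: "K \<ge> 0" by (simp add: K_def)
  have small: "cmod (LINT x|lborel. f x * of_real (h (cis x))) \<le> e * K" if "e > 0" for e
  proof -
    obtain q where q: "real_polynomial_function q" "\<And>z. z \<in> sphere 0 1 \<Longrightarrow> \<bar>h z - q z\<bar> < e"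
      using Stone_Weierstrass_real_polynomial_function[of "sphere (0::complex) 1" h e]
        \<open>e > 0\<close> continuous_on_subset[OF h] by auto
    note qf = trig_annihilator_mult_polynomial[OF q(1) f]
    have qi: "integrable lborel (\<lambda>x. f x * of_real (q (cis x)))"
      using qf by (simp add: trig_annihilator_def)
    have "(LINT x|lborel. f x * of_real (h (cis x)))
        = (LINT x|lborel. f x * of_real (h (cis x)) - f x * of_real (q (cis x)))"
      using hi qi trig_annihilator_integral_0[OF qf] by simp
    also have "cmod \<dots> \<le> (LINT x|lborel. e * cmod (f x))"
    proof (rule Bochner_Integration.integral_norm_bound_integral)
      show "cmod (f x * of_real (h (cis x)) - f x * of_real (q (cis x))) \<le> e * cmod (f x)" for x
      proof -
        have "cmod (f x * of_real (h (cis x)) - f x * of_real (q (cis x))) = cmod (f x) * \<bar>h (cis x) - q (cis x)\<bar>"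
          by (simp flip: right_diff_distrib of_real_diff add: norm_mult)
        also have "\<dots> \<le> cmod (f x) * e"
          using q(2)[of "cis x"] by (intro mult_left_mono) auto
        finally show ?thesis by (simp add: mult.commute)
      qed
    qed (use hi qi fi in auto)
    finally show ?thesis by (simp add: K_def)
  qed
  show ?thesis
  proof (rule ccontr)
    assume "(LINT x|lborel. f x * of_real (h (cis x))) \<noteq> 0"
    then have p: "cmod (LINT x|lborel. f x * of_real (h (cis x))) > 0" by simp
    have "cmod (LINT x|lborel. f x * of_real (h (cis x)))
        \<le> cmod (LINT x|lborel. f x * of_real (h (cis x))) / (2 * (K + 1)) * K"
      using p K by (intro small) auto
    also have "\<dots> < cmod (LINT x|lborel. f x * of_real (h (cis x)))"
      using p K by (simp add: field_simps add_nonneg_pos)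
    finally show False by simp
  qed
qed

text \<open>The indicator of a compact set is a pointwise limit of the continuous functions
  \<open>max 0 (1 - k infdist z C)\<close>.\<close>

lemma trig_annihilator_compact:
  assumes f: "trig_annihilator f" and C: "compact C" "C \<noteq> {}"
  shows "(LINT x|lborel. f x * indicator C (cis x)) = 0"
proof -
  have fi: "integrable lborel f" using f by (simp add: trig_annihilator_def)
  then have [measurable]: "f \<in> borel_measurable borel"
    using borel_measurable_integrable by fastforce
  have [measurable]: "cis \<in> borel_measurable borel"
    using continuous_on_cis[of UNIV "\<lambda>x. x"] by (intro borel_measurable_continuous_onI) auto
  have [measurable]: "C \<in> sets borel" by (intro borel_closed compact_imp_closed C)
  define h where "h k z = max 0 (1 - real k * infdist z C)" for k z
  have hc: "continuous_on UNIV (h k)" for k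
    unfolding h_def by (intro continuous_intros)
  have [measurable]: "h k \<in> borel_measurable borel" for k
    using hc by (rule borel_measurable_continuous_onI)
  have "(\<lambda>k. LINT x|lborel. f x * of_real (h k (cis x))) \<longlonglongrightarrow> (LINT x|lborel. f x * indicator C (cis x))"
  proof (rule integral_dominated_convergence[where w = "\<lambda>x. cmod (f x)"])
    show "AE x in lborel. (\<lambda>k. f x * of_real (h k (cis x))) \<longlonglongrightarrow> f x * indicator C (cis x)"
    proof (rule AE_I2)
      fix x :: real
      have "(\<lambda>k. h k (cis x)) \<longlonglongrightarrow> indicator C (cis x)"
      proof (cases "cis x \<in> C")
        case True then show ?thesis by (simp add: h_def)
      next
        case False
        then have "infdist (cis x) C > 0"
          using infdist_pos_not_in_closed[of C "cis x"] C compact_imp_closed by auto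
        then obtain N where N: "1 < real N * infdist (cis x) C"
          using reals_Archimedean3 by blast
        have "h k (cis x) = 0" if "k \<ge> N" for k
          using N mult_right_mono[of "real N" "real k" "infdist (cis x) C"] that
          by (simp add: h_def infdist_nonneg)
        then show ?thesis
          using False by (intro tendsto_eventually eventually_sequentiallyI[of N]) auto
      qed
      then have "(\<lambda>k. f x * of_real (h k (cis x))) \<longlonglongrightarrow> f x * of_real (indicator C (cis x))"
        by (intro tendsto_intros)
      then show "(\<lambda>k. f x * of_real (h k (cis x))) \<longlonglongrightarrow> f x * indicator C (cis x)"
        by (cases "cis x \<in> C") simp_all
    qed
    show "AE x in lborel. norm (f x * of_real (h k (cis x))) \<le> cmod (f x)" for k
      by (auto simp: norm_mult h_def infdist_nonneg intro!: mult_left_le)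
  qed (use fi in auto)
  then show ?thesis
    by (simp add: trig_annihilator_continuous[OF f hc] LIMSEQ_const_iff)
qed

text \<open>The positive and the negative part of \<open>g\<close> are densities of two finite measures that agree on a generating
  class closed under intersection.\<close>

lemma AE_zero_if_integral_Ioi_zero:
  fixes g :: "real \<Rightarrow> real"
  assumes g: "integrable lborel g" and int: "\<And>x. (LINT y|lborel. indicator {x<..} y * g y) = 0"
  shows "AE x in lborel. g x = 0"
proof -
  have [measurable]: "g \<in> borel_measurable borel"
    using borel_measurable_integrable[OF g] by simp
  define p m where "p x = max 0 (g x)" and "m x = max 0 (- g x)" for x
  have pm: "integrable lborel p" "integrable lborel m"
    unfolding p_def m_def using g by (auto intro!: integrable_max)
  have [measurable]: "p \<in> borel_measurable borel" "m \<in> borel_measurable borel"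
    unfolding p_def m_def by measurable
  have nonneg: "p x \<ge> 0" "m x \<ge> 0" "g x = p x - m x" for x
    by (auto simp: p_def m_def)
  have em: "emeasure (density lborel (\<lambda>x. ennreal (q x))) {x<..} = ennreal (LINT y|lborel. indicator {x<..} y * q y)"
    if q: "integrable lborel q" "\<And>x. q x \<ge> 0" for q :: "real \<Rightarrow> real" and x
  proof -
    have [measurable]: "q \<in> borel_measurable borel"
      using borel_measurable_integrable[OF q(1)] by simp
    have "emeasure (density lborel (\<lambda>x. ennreal (q x))) {x<..} = (\<integral>\<^sup>+y. ennreal (indicator {x<..} y * q y) \<partial>lborel)"
      by (subst emeasure_density) (auto intro!: nn_integral_cong split: split_indicator)
    also have "\<dots> = ennreal (LINT y|lborel. indicator {x<..} y * q y)"
      using q integrable_mult_indicator[of "{x<..}" lborel q]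
      by (intro nn_integral_eq_integral) auto
    finally show ?thesis .
  qed
  have "(LINT y|lborel. indicator {x<..} y * p y) = (LINT y|lborel. indicator {x<..} y * m y)" for x
  proof -
    have i: "integrable lborel (\<lambda>y. indicator {x<..} y * p y)" "integrable lborel (\<lambda>y. indicator {x<..} y * m y)"
      using pm integrable_mult_indicator[of "{x<..}" lborel p] integrable_mult_indicator[of "{x<..}" lborel m]
      by simp_all
    have "0 = (LINT y|lborel. indicator {x<..} y * p y - indicator {x<..} y * m y)"
      using int[of x] by (simp add: nonneg(3) right_diff_distrib)
    then show ?thesis using i by simp
  qed
  then have "density lborel (\<lambda>x. ennreal (p x)) = density lborel (\<lambda>x. ennreal (m x))"
    by (intro measure_eqI_lessThan) (auto simp: em pm nonneg)
  then have "AE x in lborel. ennreal (p x) = ennreal (m x)"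
    by (intro sigma_finite_measure.density_unique[OF lborel.sigma_finite_measure_axioms]) auto
  then show ?thesis
    by eventually_elim (use nonneg in auto)
qed

text \<open>Completeness of the trigonometric system. Applying \<open>trig_annihilator_compact\<close> to the arc
  \<open>C = cis ` {-pi..x}\<close> shows that \<open>f\<close> has integral \<open>0\<close> over every half-line, as \<open>cis\<close> is injective on the open
  interval.\<close>

lemma trig_annihilator_AE_zero:
  assumes f: "trig_annihilator f" and supp: "\<And>x. x \<notin> {-pi..pi} \<Longrightarrow> f x = 0"
  shows "AE x in lborel. f x = 0"
proof -
  have fi: "integrable lborel f" using f by (simp add: trig_annihilator_def)
  then have [measurable]: "f \<in> borel_measurable borel"
    using borel_measurable_integrable by fastforce
  have ind: "(LINT y|lborel. indicator {x<..} y * f y) = 0" for x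
  proof -
    consider "x < -pi" | "-pi \<le> x" "x < pi" | "pi \<le> x" by linarith
    then show ?thesis
    proof cases
      case 1
      then have "indicator {x<..} y * f y = f y" for y
        using supp[of y] by (auto split: split_indicator)
      then show ?thesis by (simp only: trig_annihilator_integral_0[OF f])
    next
      case 3
      then have "indicator {x<..} y * f y = 0" for y
        using supp[of y] by (auto split: split_indicator)
      then show ?thesis by (simp only: Bochner_Integration.integral_zero)
    next
      case 2
      define C where "C = cis ` {-pi..x}"
      have C: "compact C" "C \<noteq> {}"
        unfolding C_def using 2
        by (auto intro!: compact_continuous_image continuous_on_cis continuous_intros)
      have [measurable]: "C \<in> sets borel" by (intro borel_closed compact_imp_closed C)
      have [measurable]: "cis \<in> borel_measurable borel"
        using continuous_on_cis[of UNIV "\<lambda>x. x"] by (intro borel_measurable_continuous_onI) auto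
      have inC: "cis y \<in> C \<longleftrightarrow> y \<le> x" if y: "-pi < y" "y < pi" for y
      proof
        assume "cis y \<in> C"
        then obtain y' where y': "-pi \<le> y'" "y' \<le> x" "cis y = cis y'" by (auto simp: C_def)
        have "y' \<noteq> -pi"
        proof
          assume "y' = -pi"
          then have "cis y = cis pi" using y' by (simp add: complex_eq_iff)
          then have "Arg (cis y) = Arg (cis pi)" by (rule arg_cong)
          then show False using y Arg_cis[of y] Arg_cis[of pi] by simp
        qed
        then have "Arg (cis y') = y'" using y' 2 by (intro Arg_cis) auto
        moreover have "Arg (cis y) = y" using y by (intro Arg_cis) auto
        ultimately show "y \<le> x" using y' by simp
      qed (use y in \<open>auto simp: C_def\<close>)
      have "(LINT y|lborel. indicator {x<..} y * f y) = (LINT y|lborel. f y - f y * indicator C (cis y))"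
      proof (rule integral_cong_AE)
        \<comment> \<open>The endpoints must be left out: both are mapped to \<open>-1\<close>, which lies in \<open>C\<close>.\<close>
        show "AE y in lborel. indicator {x<..} y * f y = f y - f y * indicator C (cis y)"
          using AE_lborel_singleton[of pi] AE_lborel_singleton[of "-pi"]
        proof eventually_elim
          case (elim y)
          then show ?case
            using inC[of y] supp[of y] by (cases "y \<in> {-pi..pi}") (auto split: split_indicator)
        qed
      qed measurable
      also have "\<dots> = (LINT y|lborel. f y) - (LINT y|lborel. f y * indicator C (cis y))"
      proof (rule Bochner_Integration.integral_diff[OF fi])
        show "integrable lborel (\<lambda>y. f y * indicator C (cis y))"
          by (rule Bochner_Integration.integrable_bound[OF fi]) (auto split: split_indicator)
      qed
      also have "\<dots> = 0"
        by (simp add: trig_annihilator_integral_0[OF f] trig_annihilator_compact[OF f C])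
      finally show ?thesis .
    qed
  qed
  have indi: "integrable lborel (\<lambda>y. indicator {x<..} y * f y)" for x
    by (rule Bochner_Integration.integrable_bound[OF fi]) (auto split: split_indicator)
  have "AE x in lborel. Re (f x) = 0"
  proof (rule AE_zero_if_integral_Ioi_zero)
    fix x
    have "(LINT y|lborel. indicator {x<..} y * Re (f y)) = (LINT y|lborel. Re (indicator {x<..} y * f y))"
      by (intro Bochner_Integration.integral_cong) (auto split: split_indicator)
    also have "\<dots> = Re (LINT y|lborel. indicator {x<..} y * f y)"
      by (rule integral_Re[OF indi])
    finally show "(LINT y|lborel. indicator {x<..} y * Re (f y)) = 0"
      by (simp only: ind) simp
  qed (use fi in auto)
  moreover have "AE x in lborel. Im (f x) = 0"
  proof (rule AE_zero_if_integral_Ioi_zero)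
    fix x
    have "(LINT y|lborel. indicator {x<..} y * Im (f y)) = (LINT y|lborel. Im (indicator {x<..} y * f y))"
      by (intro Bochner_Integration.integral_cong) (auto split: split_indicator)
    also have "\<dots> = Im (LINT y|lborel. indicator {x<..} y * f y)"
      by (rule integral_Im[OF indi])
    finally show "(LINT y|lborel. indicator {x<..} y * Im (f y)) = 0"
      by (simp only: ind) simp
  qed (use fi in auto)
  ultimately show ?thesis
    by eventually_elim (simp add: complex_eq_iff)
qed


section \<open>Parseval's identity on \<open>[-\<pi>, \<pi>]\<close>\<close>

lemma L2_cases [cases type: L2]:
  obtains f where "square_integrable f" "F = abs_L2 f"
  by (metis abs_rep_L2 square_integrable_rep)

lemma square_integrable_indicator_mult:
  assumes "square_integrable f" "A \<in> sets borel"
  shows "square_integrable (\<lambda>x. indicator A x * f x)"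
  unfolding square_integrable_def
proof
  have [measurable]: "f \<in> borel_measurable borel" "A \<in> sets borel"
    using assms by (simp_all add: square_integrable_def)
  show "(\<lambda>x. indicator A x * f x) \<in> borel_measurable lborel" by measurable
  have "integrable lborel (\<lambda>x. (cmod (f x))\<^sup>2)"
    using assms by (simp add: square_integrable_def)
  then show "integrable lborel (\<lambda>x. (cmod (indicator A x * f x))\<^sup>2)"
    by (rule Bochner_Integration.integrable_bound) (auto split: split_indicator)
qed

lemma square_integrable_continuous_Icc:
  assumes "continuous_on {a..b} g"
  shows "square_integrable (\<lambda>x. indicator {a..b} x * g x)"
  unfolding square_integrable_def
proof
  have "set_integrable lborel {a..b} g"
    by (rule borel_integrable_atLeastAtMost'[OF assms])
  then have "integrable lborel (\<lambda>x. indicator {a..b} x * g x)"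
    unfolding set_integrable_def
    by (rule back_subst[of "integrable lborel"]) (auto simp: fun_eq_iff split: split_indicator)
  then show "(\<lambda>x. indicator {a..b} x * g x) \<in> borel_measurable lborel"
    by (rule borel_measurable_integrable)
  have "set_integrable lborel {a..b} (\<lambda>x. (cmod (g x))\<^sup>2)"
    by (intro borel_integrable_atLeastAtMost' continuous_intros assms)
  then have "integrable lborel (\<lambda>x. indicator {a..b} x *\<^sub>R (cmod (g x))\<^sup>2)"
    unfolding set_integrable_def .
  moreover have "(cmod (indicator {a..b} x * g x))\<^sup>2 = indicator {a..b} x *\<^sub>R (cmod (g x))\<^sup>2" for x
    by (simp split: split_indicator)
  ultimately show "integrable lborel (\<lambda>x. (cmod (indicator {a..b} x * g x))\<^sup>2)"
    by simp
qed

lift_definition trunc :: "real \<Rightarrow> L2 \<Rightarrow> L2" is "\<lambda>R f x. indicator {-R..R} x * f x"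
  unfolding L2_eq_def by (auto simp: square_integrable_indicator_mult)

lemma trunc_abs_L2:
  "square_integrable f \<Longrightarrow> trunc R (abs_L2 f) = abs_L2 (\<lambda>x. indicator {-R..R} x * f x)"
  by (simp add: trunc.abs_eq)

lemma trunc_add: "trunc R (f + g) = trunc R f + trunc R g"
  by transfer (auto simp: L2_eq_def distrib_left intro!: square_integrable_add square_integrable_indicator_mult)

lemma trunc_scaleC: "trunc R (scaleC c f) = scaleC c (trunc R f)"
  by transfer (auto simp: L2_eq_def mult.left_commute intro!: square_integrable_scale square_integrable_indicator_mult)

lemma norm_trunc_le: "norm (trunc R f) \<le> norm f"
proof (cases f)
  case (1 h)
  have i: "square_integrable (\<lambda>x. indicator {-R..R} x * h x)"
    using 1 by (intro square_integrable_indicator_mult) auto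
  have "(norm (trunc R f))\<^sup>2 \<le> (norm f)\<^sup>2"
    unfolding 1(2) trunc_abs_L2[OF 1(1)] norm_abs_L2[OF 1(1)] norm_abs_L2[OF i]
    using 1(1) i by (intro integral_mono) (auto simp: square_integrable_def split: split_indicator)
  then show ?thesis by (rule power2_le_imp_le) simp
qed

lemma bounded_linear_trunc: "bounded_linear (trunc R)"
  by (rule bounded_linear_intro[where K = 1])
    (auto simp: trunc_add scaleR_L2_def trunc_scaleC norm_trunc_le)

lemma square_integrable_band_exp:
  "square_integrable (\<lambda>\<xi>. indicator {-pi..pi} \<xi> * exp (- (\<i> * w * of_real \<xi>)))"
  by (auto intro!: square_integrable_continuous_Icc continuous_intros)

text \<open>The transform of \<open>sinc (w - t)\<close>.\<close>

lift_definition band_exp :: "complex \<Rightarrow> L2" is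
  "\<lambda>w \<xi>. indicator {-pi..pi} \<xi> * exp (- (\<i> * w * of_real \<xi>))"
  by (simp add: square_integrable_band_exp)

lemma trunc_band_exp: "trunc pi (band_exp w) = band_exp w"
  unfolding band_exp.abs_eq trunc_abs_L2[OF square_integrable_band_exp]
  by (rule arg_cong[of _ _ abs_L2]) (auto split: split_indicator)

lemma integral_exp_csinc:
  "(LINT \<xi>|lborel. indicator {-pi..pi} \<xi> * exp (\<i> * w * of_real \<xi>)) = 2 * pi * csinc w"
proof -
  have *: "indicator {-pi..pi} \<xi> * exp (\<i> * w * of_real \<xi>) = indicator {-pi..pi} \<xi> *\<^sub>R exp (\<i> * w * of_real \<xi>)" for \<xi>
    by (simp split: split_indicator)
  show ?thesis
  proof (cases "w = 0")
    case True
    have "(LINT \<xi>|lborel. indicator {-pi..pi} \<xi> *\<^sub>R (1::complex)) = of_real pi - of_real (-pi)"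
      by (rule integral_FTC_Icc) (auto intro!: derivative_eq_intros continuous_intros
          simp: has_vector_derivative_def scaleR_conv_of_real)
    then show ?thesis
      unfolding * using True by (simp add: csinc_def scaleR_conv_of_real)
  next
    case False
    define F where "F \<xi> = exp (\<i> * w * of_real \<xi>) / (\<i> * w)" for \<xi> :: real
    have "(LINT \<xi>|lborel. indicator {-pi..pi} \<xi> *\<^sub>R exp (\<i> * w * of_real \<xi>)) = F pi - F (-pi)"
    proof (rule integral_FTC_Icc)
      show "(F has_vector_derivative exp (\<i> * w * of_real x)) (at x within {-pi..pi})" for x
        unfolding F_def using False
        by (auto intro!: derivative_eq_intros has_vector_derivative_real_field simp: field_simps)
    qed (auto intro!: continuous_intros)
    also have "\<dots> = 2 * pi * csinc w"
      using False by (simp add: F_def csinc_def sin_exp_eq field_simps)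
    finally show ?thesis unfolding * .
  qed
qed

lemma csinc_of_int: "csinc (of_int n) = (if n = 0 then 1 else 0)"
proof -
  have "sin (pi * of_int n) = 0"
    by (metis mult.commute sin_zero_iff_int2)
  then have "sin (complex_of_real (pi * of_int n)) = 0"
    unfolding sin_of_real by simp
  then have "sin (complex_of_real pi * of_int n) = 0"
    by simp
  then show ?thesis
    by (simp add: csinc_def mult.commute)
qed

lemma cinner_abs_L2:
  "square_integrable f \<Longrightarrow> square_integrable g \<Longrightarrow> cinner (abs_L2 f) (abs_L2 g) = (LINT x|lborel. f x * cnj (g x))"
  by (simp add: cinner.abs_eq)

lemma cinner_band_exp: "cinner (band_exp v) (band_exp w) = 2 * pi * csinc (cnj w - v)"
proof -
  have "cinner (band_exp v) (band_exp w) = (LINT \<xi>|lborel. indicator {-pi..pi} \<xi> * exp (\<i> * (cnj w - v) * of_real \<xi>))"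
    by transfer (auto intro!: Bochner_Integration.integral_cong
        simp: exp_cnj algebra_simps simp flip: exp_add split: split_indicator)
  then show ?thesis by (simp add: integral_exp_csinc)
qed

definition trig_basis :: "int \<Rightarrow> L2"
  where "trig_basis n = scaleC (of_real (1 / sqrt (2 * pi))) (band_exp (of_int n))"

lemma orthonormal_trig_basis: "orthonormal trig_basis"
  unfolding orthonormal_def
proof (intro allI)
  fix m n :: int
  define c where "c = 1 / sqrt (2 * pi)"
  have "c * c * (2 * pi) = 1"
    by (simp add: c_def)
  then have c: "complex_of_real c * complex_of_real c * complex_of_real (2 * pi) = 1"
    by (metis of_real_1 of_real_mult)
  then show "cinner (trig_basis m) (trig_basis n) = (if m = n then 1 else 0)"
    using csinc_of_int[of "n - m"] c
    by (simp add: trig_basis_def cinner_scaleC_left cinner_scaleC_right cinner_band_exp mult.assoc flip: c_def)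
qed

lemma trunc_trig_basis: "trunc pi (trig_basis n) = trig_basis n"
  by (simp add: trig_basis_def trunc_scaleC trunc_band_exp)

text \<open>Completeness of the trigonometric system in the language of \<open>L\<^sup>2\<close>.\<close>

lemma trunc_eq_0_if_orthogonal:
  assumes "\<And>n::int. cinner f (band_exp (of_int n)) = 0"
  shows "trunc pi f = 0"
proof (cases f)
  case (1 h)
  define g where "g x = indicator {-pi..pi} x * h x" for x
  note e = square_integrable_band_exp
  have *: "h x * cnj (indicator {-pi..pi} x * exp (- (\<i> * of_int n * of_real x))) = g x * cis (of_int n * x)" for n x
    by (auto simp: g_def cis_conv_exp exp_cnj mult.assoc split: split_indicator)
  have "(LINT x|lborel. g x * cis (of_int n * x)) = 0" for n
    using assms[of n] unfolding 1(2) band_exp.abs_eq cinner_abs_L2[OF 1(1) e] * .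
  moreover have "integrable lborel g"
    using square_integrable_mult_cnj[OF 1(1) e, of "of_int 0"] unfolding * by simp
  ultimately have "trig_annihilator g"
    by (simp add: trig_annihilator_def)
  then have "AE x in lborel. g x = 0"
    by (rule trig_annihilator_AE_zero) (auto simp: g_def)
  then have "L2_eq g (\<lambda>x. 0)"
    using square_integrable_indicator_mult[OF 1(1), of "{-pi..pi}"]
    by (simp add: L2_eq_def g_def[abs_def] square_integrable_0)
  then have "abs_L2 g = 0"
    unfolding zero_L2_def by (rule Quotient_rel_abs[OF Quotient_L2])
  then show ?thesis
    by (simp add: 1(2) trunc_abs_L2[OF 1(1)] g_def[abs_def])
qed

text \<open>The difference between \<open>f\<close> and the sum of its Fourier series is supported in \<open>[-\<pi>, \<pi>]\<close> and
  orthogonal to the trigonometric system.\<close>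

lemma trig_expansion:
  assumes "trunc pi f = f"
  shows "((\<lambda>n. scaleC (cinner f (trig_basis n)) (trig_basis n)) has_sum f) UNIV"
proof -
  define s where "s = (\<Sum>\<^sub>\<infinity>n. scaleC (cinner f (trig_basis n)) (trig_basis n))"
  have s: "((\<lambda>n. scaleC (cinner f (trig_basis n)) (trig_basis n)) has_sum s) UNIV"
    unfolding s_def
    by (intro has_sum_infsum dominated_summable[OF orthonormal_trig_basis dominated_by_refl]) simp
  have "trunc pi s = s"
    using has_sum_bounded_linear[OF bounded_linear_trunc[of pi] s]
    by (intro has_sum_unique[OF _ s]) (simp add: trunc_scaleC trunc_trig_basis)
  then have "trunc pi (f - s) = f - s"
    using trunc_add[of pi "f - s" s] assms by (metis add_diff_cancel_right' diff_add_cancel)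
  moreover have "trunc pi (f - s) = 0"
  proof (rule trunc_eq_0_if_orthogonal)
    fix n
    have "cinner (f - s) (trig_basis n) = 0"
      by (simp add: s_def cinner_diff_left cinner_Fourier_infsum[OF orthonormal_trig_basis])
    then show "cinner (f - s) (band_exp (of_int n)) = 0"
      by (simp add: trig_basis_def cinner_scaleC_right)
  qed
  ultimately show ?thesis using s by simp
qed


section \<open>Plancherel's theorem for functions of bounded support\<close>

lemma square_integrable_mult_unimodular:
  assumes "square_integrable g" "continuous_on UNIV u" "\<And>x. cmod (u x) = 1"
  shows "square_integrable (\<lambda>x. g x * u x)"
proof -
  have [measurable]: "u \<in> borel_measurable borel" "g \<in> borel_measurable borel"
    using assms by (simp_all add: borel_measurable_continuous_onI square_integrable_def)
  show ?thesis
    using assms by (simp add: square_integrable_def norm_mult)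
qed

lemma trunc_abs_L2_supported:
  assumes "square_integrable g" "\<And>x. x \<notin> {-R..R} \<Longrightarrow> g x = 0"
  shows "trunc R (abs_L2 g) = abs_L2 g"
  unfolding trunc_abs_L2[OF assms(1)]
  by (rule arg_cong[of _ _ abs_L2]) (use assms(2) in \<open>auto simp: fun_eq_iff split: split_indicator\<close>)

text \<open>Up to normalization the values of the transform of \<open>g\<close> at \<open>\<theta> - m\<close> are the Fourier coefficients of the
  modulated function \<open>g(x) exp (- \<i> \<theta> x)\<close>, which has the same modulus as \<open>g\<close>, so this is Parseval's identity.\<close>

lemma has_sum_fourier_integral_translates:
  assumes g: "square_integrable g" and supp: "\<And>x. x \<notin> {-pi..pi} \<Longrightarrow> g x = 0"
  shows "((\<lambda>m::int. (cmod (fourier_integral g (\<theta> - of_int m)))\<^sup>2) has_sum (2 * pi * (LINT x|lborel. (cmod (g x))\<^sup>2))) UNIV"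
proof -
  define G where "G x = g x * exp (- (\<i> * of_real (\<theta> * x)))" for x
  have G: "square_integrable G"
    unfolding G_def
    by (rule square_integrable_mult_unimodular[OF g]) (auto intro!: continuous_intros)
  have nG: "(norm (abs_L2 G))\<^sup>2 = (LINT x|lborel. (cmod (g x))\<^sup>2)"
    unfolding norm_abs_L2[OF G] by (simp add: G_def norm_mult)
  have tG: "trunc pi (abs_L2 G) = abs_L2 G"
    by (rule trunc_abs_L2_supported[OF G]) (simp add: G_def supp)
  have c: "cinner (abs_L2 G) (band_exp (of_int m)) = fourier_integral g (\<theta> - of_int m)" for m
    unfolding band_exp.abs_eq cinner_abs_L2[OF G square_integrable_band_exp] fourier_integral_def
  proof (intro Bochner_Integration.integral_cong refl)
    fix x :: real
    show "G x * cnj (indicator {-pi..pi} x * exp (- (\<i> * of_int m * of_real x)))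
        = g x * exp (- (\<i> * of_real ((\<theta> - of_int m) * x)))"
      using supp[of x]
      by (cases "x \<in> {-pi..pi}")
        (auto simp: G_def exp_cnj mult.assoc algebra_simps simp flip: exp_add)
  qed
  have "((\<lambda>m. (cmod (cinner (abs_L2 G) (trig_basis m)))\<^sup>2) has_sum (norm (abs_L2 G))\<^sup>2) UNIV"
    by (rule Parseval[OF orthonormal_trig_basis trig_expansion[OF tG]])
  then have "((\<lambda>m. 2 * pi * (cmod (cinner (abs_L2 G) (trig_basis m)))\<^sup>2) has_sum 2 * pi * (norm (abs_L2 G))\<^sup>2) UNIV"
    by (rule has_sum_cmult_right)
  moreover have "2 * pi * (cmod (cinner (abs_L2 G) (trig_basis m)))\<^sup>2 = (cmod (fourier_integral g (\<theta> - of_int m)))\<^sup>2" for m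
    by (simp add: trig_basis_def cinner_scaleC_right c norm_mult norm_divide power_divide)
  ultimately show ?thesis
    by (simp add: nG)
qed

lemma nn_integral_count_space_has_sum:
  fixes c :: "'i \<Rightarrow> real"
  assumes "(c has_sum s) UNIV" "\<And>n. c n \<ge> 0"
  shows "(\<integral>\<^sup>+n. ennreal (c n) \<partial>count_space UNIV) = ennreal s"
proof -
  have "Infinite_Set_Sum.abs_summable_on c UNIV"
    unfolding abs_summable_equivalent[symmetric] using assms has_sum_imp_summable[OF assms(1)] by simp
  then show ?thesis
    using nn_integral_conv_infsetsum[of c UNIV] infsetsum_infsum[of c UNIV] assms infsumI[OF assms(1)] by simp
qed

text \<open>The translates of \<open>[0, 1)\<close> by integers tile the line; the exchange of sum and integral is Tonelli.\<close>

lemma nn_integral_lborel_integer_translates: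
  fixes f :: "real \<Rightarrow> ennreal"
  assumes [measurable]: "f \<in> borel_measurable borel"
  shows "(\<integral>\<^sup>+x. f x \<partial>lborel)
    = (\<integral>\<^sup>+\<theta>. indicator {0..<1::real} \<theta> * (\<integral>\<^sup>+m. f (\<theta> - of_int m) \<partial>count_space (UNIV :: int set)) \<partial>lborel)"
proof -
  have one: "(\<integral>\<^sup>+m. indicator {0..<1} (x + of_int m :: real) \<partial>count_space (UNIV :: int set)) = (1::ennreal)" for x :: real
  proof -
    have "indicator {0..<1} (x + of_int m) = (indicator {- \<lfloor>x\<rfloor>} m :: ennreal)" for m :: int
    proof -
      have "x + of_int m \<in> {0..<1} \<longleftrightarrow> m = - \<lfloor>x\<rfloor>"
        using floor_eq_iff[of x "-m"] by auto
      then show ?thesis by (simp add: indicator_def)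
    qed
    then show ?thesis by simp
  qed
  have "(\<integral>\<^sup>+\<theta>. indicator {0..<1::real} \<theta> * (\<integral>\<^sup>+m. f (\<theta> - of_int m) \<partial>count_space (UNIV :: int set)) \<partial>lborel)
      = (\<integral>\<^sup>+\<theta>. (\<integral>\<^sup>+m. indicator {0..<1::real} \<theta> * f (\<theta> - of_int m) \<partial>count_space (UNIV :: int set)) \<partial>lborel)"
    by (simp add: nn_integral_cmult)
  also have "\<dots> = (\<integral>\<^sup>+m. (\<integral>\<^sup>+\<theta>. indicator {0..<1::real} \<theta> * f (\<theta> - of_int m) \<partial>lborel) \<partial>count_space (UNIV :: int set))"
    by (rule nn_integral_count_space_nn_integral) (auto intro: uncountable_def)
  also have "\<dots> = (\<integral>\<^sup>+m. (\<integral>\<^sup>+x. indicator {0..<1} (x + of_int m) * f x \<partial>lborel) \<partial>count_space (UNIV :: int set))"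
  proof (rule nn_integral_cong)
    fix m :: int
    show "(\<integral>\<^sup>+\<theta>. indicator {0..<1::real} \<theta> * f (\<theta> - of_int m) \<partial>lborel) = (\<integral>\<^sup>+x. indicator {0..<1} (x + of_int m) * f x \<partial>lborel)"
      by (subst nn_integral_real_affine[where c = 1 and t = "of_int m"]) (auto simp: add.commute)
  qed
  also have "\<dots> = (\<integral>\<^sup>+x. (\<integral>\<^sup>+m. indicator {0..<1} (x + of_int m) * f x \<partial>count_space (UNIV :: int set)) \<partial>lborel)"
    by (rule nn_integral_count_space_nn_integral[symmetric]) auto
  also have "\<dots> = (\<integral>\<^sup>+x. f x \<partial>lborel)"
    by (simp add: nn_integral_multc one)
  finally show ?thesis by simp
qed

lemma borel_measurable_fourier_integral [measurable]:
  assumes [measurable]: "g \<in> borel_measurable borel"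
  shows "fourier_integral g \<in> borel_measurable borel"
  unfolding fourier_integral_def by measurable

lemma Plancherel_pi:
  assumes g: "square_integrable g" and supp: "\<And>x. x \<notin> {-pi..pi} \<Longrightarrow> g x = 0"
  shows "(\<integral>\<^sup>+\<xi>. ennreal ((cmod (fourier_integral g \<xi>))\<^sup>2) \<partial>lborel)
    = ennreal (2 * pi) * (\<integral>\<^sup>+x. ennreal ((cmod (g x))\<^sup>2) \<partial>lborel)"
proof -
  have [measurable]: "g \<in> borel_measurable borel"
    using g by (simp add: square_integrable_def)
  have "(\<integral>\<^sup>+\<xi>. ennreal ((cmod (fourier_integral g \<xi>))\<^sup>2) \<partial>lborel)
      = (\<integral>\<^sup>+\<theta>. indicator {0..<1::real} \<theta> *
        (\<integral>\<^sup>+m. ennreal ((cmod (fourier_integral g (\<theta> - of_int m)))\<^sup>2) \<partial>count_space (UNIV :: int set)) \<partial>lborel)"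
    by (rule nn_integral_lborel_integer_translates) measurable
  also have "\<dots> = (\<integral>\<^sup>+\<theta>. indicator {0..<1::real} \<theta> * ennreal (2 * pi * (LINT x|lborel. (cmod (g x))\<^sup>2)) \<partial>lborel)"
    by (subst nn_integral_count_space_has_sum[OF has_sum_fourier_integral_translates[OF assms]]) simp_all
  also have "\<dots> = ennreal (2 * pi * (LINT x|lborel. (cmod (g x))\<^sup>2))"
    by (subst nn_integral_multc) simp_all
  also have "\<dots> = ennreal (2 * pi) * (\<integral>\<^sup>+x. ennreal ((cmod (g x))\<^sup>2) \<partial>lborel)"
    unfolding nn_integral_abs_L2[OF g] norm_abs_L2[OF g] by (rule ennreal_mult) simp_all
  finally show ?thesis .
qed

text \<open>The support is brought into \<open>[-\<pi>, \<pi>]\<close> by the substitution \<open>x \<mapsto> R x / \<pi>\<close>.\<close>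

theorem Plancherel_bounded_support:
  assumes h: "square_integrable h" and supp: "\<And>x. x \<notin> {-R..R} \<Longrightarrow> h x = 0" and R: "R > 0"
  shows "(\<integral>\<^sup>+\<xi>. ennreal ((cmod (fourier_integral h \<xi>))\<^sup>2) \<partial>lborel)
    = ennreal (2 * pi) * (\<integral>\<^sup>+x. ennreal ((cmod (h x))\<^sup>2) \<partial>lborel)"
proof -
  define c where "c = R / pi"
  have c: "c > 0" using R by (simp add: c_def)
  have [measurable]: "h \<in> borel_measurable borel"
    using h by (simp add: square_integrable_def)
  define H where "H x = h (c * x)" for x
  have [measurable]: "H \<in> borel_measurable borel"
    unfolding H_def by measurable
  have nH: "(\<integral>\<^sup>+x. ennreal ((cmod (h x))\<^sup>2) \<partial>lborel) = ennreal c * (\<integral>\<^sup>+x. ennreal ((cmod (H x))\<^sup>2) \<partial>lborel)"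
    using c by (subst nn_integral_real_affine[where c = c and t = 0]) (auto simp: H_def)
  have "integrable lborel (\<lambda>x. (cmod (h (0 + c * x)))\<^sup>2)"
    using h c by (intro lborel_integrable_real_affine[where f = "\<lambda>x. (cmod (h x))\<^sup>2"]) (auto simp: square_integrable_def)
  then have H: "square_integrable H"
    by (simp add: square_integrable_def H_def)
  have suppH: "H x = 0" if "x \<notin> {-pi..pi}" for x
  proof -
    have "R = c * pi" by (simp add: c_def)
    then have "c * x \<in> {c * (-pi)..c * pi} \<longleftrightarrow> c * x \<in> {-R..R}" by simp
    then have "c * x \<notin> {-R..R}"
      using that c by (simp only: atLeastAtMost_iff mult_le_cancel_left_pos) auto
    then show ?thesis by (simp add: H_def supp)
  qed
  have fh: "fourier_integral h \<xi> = c * fourier_integral H (c * \<xi>)" for \<xi>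
    unfolding fourier_integral_def using c
    by (subst lborel_integral_real_affine[where c = c and t = 0])
      (auto simp: H_def scaleR_conv_of_real mult_ac)
  have "(\<integral>\<^sup>+\<xi>. ennreal ((cmod (fourier_integral h \<xi>))\<^sup>2) \<partial>lborel)
      = (\<integral>\<^sup>+\<xi>. ennreal (c\<^sup>2) * ennreal ((cmod (fourier_integral H (c * \<xi>)))\<^sup>2) \<partial>lborel)"
    using c by (simp add: fh norm_mult power_mult_distrib ennreal_mult)
  also have "\<dots> = ennreal (c\<^sup>2) * (\<integral>\<^sup>+\<xi>. ennreal ((cmod (fourier_integral H (c * \<xi>)))\<^sup>2) \<partial>lborel)"
    by (rule nn_integral_cmult) measurable
  also have "\<dots> = ennreal c * (ennreal c * (\<integral>\<^sup>+\<xi>. ennreal ((cmod (fourier_integral H (0 + c * \<xi>)))\<^sup>2) \<partial>lborel))"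
    using c by (simp add: power2_eq_square ennreal_mult mult.assoc)
  also have "ennreal c * (\<integral>\<^sup>+\<xi>. ennreal ((cmod (fourier_integral H (0 + c * \<xi>)))\<^sup>2) \<partial>lborel)
      = (\<integral>\<^sup>+\<xi>. ennreal ((cmod (fourier_integral H \<xi>))\<^sup>2) \<partial>lborel)"
    using c nn_integral_real_affine[where c = c and t = 0 and f = "\<lambda>\<xi>. ennreal ((cmod (fourier_integral H \<xi>))\<^sup>2)"]
    by simp
  also have "\<dots> = ennreal (2 * pi) * (\<integral>\<^sup>+x. ennreal ((cmod (H x))\<^sup>2) \<partial>lborel)"
    by (rule Plancherel_pi[OF H suppH])
  also have "ennreal c * \<dots> = ennreal (2 * pi) * (ennreal c * (\<integral>\<^sup>+x. ennreal ((cmod (H x))\<^sup>2) \<partial>lborel))"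
    by (simp add: mult_ac)
  finally show ?thesis
    by (simp only: nH)
qed


section \<open>The truncated Fourier transform on \<open>L\<^sup>2\<close>\<close>

lemma integrable_trunc:
  assumes "square_integrable f"
  shows "integrable lborel (\<lambda>t. indicator {-R..R} t * f t)"
proof -
  have "square_integrable (\<lambda>t. indicator {-R..R} t * 1)"
    by (rule square_integrable_continuous_Icc) simp
  from square_integrable_mult_cnj[OF assms this] show ?thesis
    by (rule back_subst[of "integrable lborel"]) (auto simp: fun_eq_iff split: split_indicator)
qed

lemma Plancherel_trunc:
  assumes "square_integrable f"
  shows "(\<integral>\<^sup>+\<xi>. ennreal ((cmod (fourier_integral (\<lambda>t. indicator {-R..R} t * f t) \<xi>))\<^sup>2) \<partial>lborel)
    = ennreal (2 * pi) * (\<integral>\<^sup>+x. ennreal ((cmod (indicator {-R..R} x * f x))\<^sup>2) \<partial>lborel)"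
  \<comment> \<open>For \<open>R \<le> 0\<close> the truncation vanishes off \<open>0\<close>, and the radius \<open>1\<close> serves as well.\<close>
  by (rule Plancherel_bounded_support[where R = "max R 1"])
    (auto intro!: square_integrable_indicator_mult assms split: split_indicator)

lemma square_integrable_fourier_integral_trunc:
  assumes "square_integrable f"
  shows "square_integrable (fourier_integral (\<lambda>t. indicator {-R..R} t * f t))"
proof (rule square_integrableI_nn_integral)
  have [measurable]: "f \<in> borel_measurable borel"
    using assms by (simp add: square_integrable_def)
  show "fourier_integral (\<lambda>t. indicator {-R..R} t * f t) \<in> borel_measurable lborel"
    by measurable
  show "(\<integral>\<^sup>+\<xi>. ennreal ((cmod (fourier_integral (\<lambda>t. indicator {-R..R} t * f t) \<xi>))\<^sup>2) \<partial>lborel) < \<infinity>"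
    unfolding Plancherel_trunc[OF assms]
      nn_integral_abs_L2[OF square_integrable_indicator_mult[OF assms, of "{-R..R}", simplified]]
    by (simp flip: ennreal_mult)
qed

lemma fourier_integral_trunc_cong:
  assumes "L2_eq f g"
  shows "fourier_integral (\<lambda>t. indicator {-R..R} t * f t) = fourier_integral (\<lambda>t. indicator {-R..R} t * g t)"
proof -
  have [measurable]: "f \<in> borel_measurable borel" "g \<in> borel_measurable borel"
    and ae: "AE t in lborel. f t = g t"
    using assms by (simp_all add: L2_eq_def square_integrable_def)
  show ?thesis
    unfolding fourier_integral_def by (intro ext integral_cong_AE) (use ae in \<open>measurable, auto\<close>)
qed

text \<open>In these terms \<open>f\<close> has the transform \<open>g\<close> if and only if \<open>trunc_fourier R f\<close> tends to \<open>g\<close> in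
  \<open>L\<^sup>2\<close> as \<open>R\<close> grows (\<open>has_fourier_transform_iff_tendsto\<close>). Plancherel for bounded supports makes it well
  defined.\<close>

lift_definition trunc_fourier :: "real \<Rightarrow> L2 \<Rightarrow> L2" is
  "\<lambda>R f. fourier_integral (\<lambda>t. indicator {-R..R} t * f t)"
proof -
  fix R f g assume fg: "L2_eq f g"
  then show "L2_eq (fourier_integral (\<lambda>t. indicator {-R..R} t * f t))
      (fourier_integral (\<lambda>t. indicator {-R..R} t * g t))"
    unfolding fourier_integral_trunc_cong[OF fg, symmetric]
    by (simp add: L2_eq_def square_integrable_fourier_integral_trunc)
qed

text \<open>The inverse transform of the restriction of \<open>g\<close> to \<open>[-\<pi>, \<pi>]\<close>, written through the forward
  transform so that Plancherel applies to it.\<close>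

definition band_synthesis_fun :: "(real \<Rightarrow> complex) \<Rightarrow> real \<Rightarrow> complex"
  where "band_synthesis_fun g t = 1 / (2 * pi) * fourier_integral (\<lambda>\<xi>. indicator {-pi..pi} \<xi> * g \<xi>) (- t)"

lemma square_integrable_band_synthesis_fun:
  assumes "square_integrable g"
  shows "square_integrable (band_synthesis_fun g)"
proof -
  define F where "F = fourier_integral (\<lambda>\<xi>. indicator {-pi..pi} \<xi> * g \<xi>)"
  have "square_integrable F"
    unfolding F_def by (intro square_integrable_fourier_integral_trunc assms)
  then have F: "F \<in> borel_measurable borel" "integrable lborel (\<lambda>x. (cmod (F x))\<^sup>2)"
    by (simp_all add: square_integrable_def)
  have "integrable lborel (\<lambda>x. (cmod (F (0 + (-1) * x)))\<^sup>2)"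
    by (rule lborel_integrable_real_affine[OF F(2)]) simp
  moreover have "(\<lambda>t. F (- t)) \<in> borel_measurable borel"
    using F(1) by measurable
  ultimately have "square_integrable (\<lambda>t. F (- t))"
    by (simp add: square_integrable_def)
  then have "square_integrable (\<lambda>t. 1 / (2 * pi) * F (- t))"
    by (rule square_integrable_scale)
  then show ?thesis
    unfolding F_def band_synthesis_fun_def[abs_def] .
qed

lift_definition band_synthesis :: "L2 \<Rightarrow> L2" is band_synthesis_fun
proof -
  fix f g assume fg: "L2_eq f g"
  then have "band_synthesis_fun f = band_synthesis_fun g"
    unfolding band_synthesis_fun_def[abs_def] fourier_integral_trunc_cong[OF fg] by simp
  then show "L2_eq (band_synthesis_fun f) (band_synthesis_fun g)"
    using fg by (auto simp: L2_eq_def square_integrable_band_synthesis_fun)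
qed

lemma band_synthesis_abs_L2: "square_integrable g \<Longrightarrow> band_synthesis (abs_L2 g) = abs_L2 (band_synthesis_fun g)"
  by (simp add: band_synthesis.abs_eq)

lemma norm_trunc_fourier: "(norm (trunc_fourier R f))\<^sup>2 = 2 * pi * (norm (trunc R f))\<^sup>2"
proof (cases f)
  case (1 h)
  have i: "square_integrable (\<lambda>x. indicator {-R..R} x * h x)"
    using 1 by (intro square_integrable_indicator_mult) auto
  have "ennreal ((norm (trunc_fourier R f))\<^sup>2) = ennreal (2 * pi) * ennreal ((norm (trunc R f))\<^sup>2)"
    using Plancherel_trunc[OF 1(1), of R]
      nn_integral_abs_L2[OF square_integrable_fourier_integral_trunc[OF 1(1)], of R] nn_integral_abs_L2[OF i]
    by (simp add: 1 trunc_abs_L2 trunc_fourier.abs_eq)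
  then show ?thesis
    by (simp flip: ennreal_mult)
qed

lemma norm_band_synthesis: "2 * pi * (norm (band_synthesis g))\<^sup>2 = (norm (trunc pi g))\<^sup>2"
proof (cases g)
  case (1 h)
  define F where "F = fourier_integral (\<lambda>\<xi>. indicator {-pi..pi} \<xi> * h \<xi>)"
  have F: "square_integrable F"
    unfolding F_def by (rule square_integrable_fourier_integral_trunc[OF 1(1)])
  have nF: "(norm (abs_L2 F))\<^sup>2 = 2 * pi * (norm (trunc pi g))\<^sup>2"
    using norm_trunc_fourier[of pi g] 1 by (simp add: trunc_fourier.abs_eq F_def)
  have "(norm (band_synthesis g))\<^sup>2 = (LINT t|lborel. (cmod (1 / (2 * pi) * F (- t)))\<^sup>2)"
    using norm_abs_L2[OF square_integrable_band_synthesis_fun[OF 1(1)]] 1 by (simp add: band_synthesis_abs_L2 F_def band_synthesis_fun_def)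
  also have "\<dots> = (LINT t|lborel. (1 / (2 * pi))\<^sup>2 * (cmod (F (0 + (-1) * t)))\<^sup>2)"
    by (simp add: norm_mult norm_divide power_divide)
  also have "\<dots> = (1 / (2 * pi))\<^sup>2 * (LINT t|lborel. (cmod (F (0 + (-1) * t)))\<^sup>2)"
    by (rule Bochner_Integration.integral_mult_right_zero)
  also have "(LINT t|lborel. (cmod (F (0 + (-1) * t)))\<^sup>2) = (LINT t|lborel. (cmod (F t))\<^sup>2)"
    using lborel_integral_real_affine[of "-1" "\<lambda>t. (cmod (F t))\<^sup>2" 0] by simp
  also have "\<dots> = 2 * pi * (norm (trunc pi g))\<^sup>2"
    using norm_abs_L2[OF F] nF by simp
  finally show ?thesis
    by (simp add: power2_eq_square)
qed

lemma norm_band_synthesis_supported: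
  assumes "trunc pi g = g"
  shows "norm g = sqrt (2 * pi) * norm (band_synthesis g)"
proof -
  have "(norm g)\<^sup>2 = (sqrt (2 * pi) * norm (band_synthesis g))\<^sup>2"
    using norm_band_synthesis[of g] assms by (simp add: power_mult_distrib)
  then show ?thesis
    by (simp add: power2_eq_iff_nonneg)
qed

lemma fourier_integral_add:
  "integrable lborel f \<Longrightarrow> integrable lborel g \<Longrightarrow>
    fourier_integral (\<lambda>t. f t + g t) \<xi> = fourier_integral f \<xi> + fourier_integral g \<xi>"
  unfolding fourier_integral_def distrib_right
  by (rule Bochner_Integration.integral_add)
    (auto intro!: integrable_mult_bounded_continuous[where B = 1] continuous_intros)

lemma fourier_integral_scale: "fourier_integral (\<lambda>t. c * f t) \<xi> = c * fourier_integral f \<xi>"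
  unfolding fourier_integral_def mult.assoc by simp

lemma trunc_fourier_add: "trunc_fourier R (f + g) = trunc_fourier R f + trunc_fourier R g"
proof (cases f)
  case f: (1 u)
  show ?thesis
  proof (cases g)
    case g: (1 v)
    have eq: "fourier_integral (\<lambda>t. indicator {-R..R} t * (u t + v t))
        = (\<lambda>\<xi>. fourier_integral (\<lambda>t. indicator {-R..R} t * u t) \<xi>
          + fourier_integral (\<lambda>t. indicator {-R..R} t * v t) \<xi>)"
      unfolding distrib_left
      by (rule ext) (rule fourier_integral_add[OF integrable_trunc[OF f(1)] integrable_trunc[OF g(1)]])
    show ?thesis
      using f g by (simp add: plus_L2.abs_eq trunc_fourier.abs_eq square_integrable_add
          square_integrable_fourier_integral_trunc eq)
  qed
qed

lemma trunc_fourier_diff: "trunc_fourier R (f - g) = trunc_fourier R f - trunc_fourier R g"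
  using trunc_fourier_add[of R "f - g" g] by simp

lemma band_synthesis_add: "band_synthesis (f + g) = band_synthesis f + band_synthesis g"
proof (cases f)
  case f: (1 u)
  show ?thesis
  proof (cases g)
    case g: (1 v)
    have eq: "band_synthesis_fun (\<lambda>x. u x + v x) = (\<lambda>t. band_synthesis_fun u t + band_synthesis_fun v t)"
      unfolding band_synthesis_fun_def[abs_def] distrib_left
        fourier_integral_add[OF integrable_trunc[OF f(1)] integrable_trunc[OF g(1)]] ..
    show ?thesis
      using f g by (simp add: plus_L2.abs_eq band_synthesis_abs_L2 square_integrable_add
          square_integrable_band_synthesis_fun eq)
  qed
qed

lemma band_synthesis_scaleC: "band_synthesis (scaleC c f) = scaleC c (band_synthesis f)"
proof (cases f)
  case f: (1 u)
  have eq: "band_synthesis_fun (\<lambda>x. c * u x) = (\<lambda>t. c * band_synthesis_fun u t)"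
    unfolding band_synthesis_fun_def[abs_def] mult.left_commute[of _ c] fourier_integral_scale ..
  show ?thesis
    using f by (simp add: scaleC.abs_eq band_synthesis_abs_L2 square_integrable_scale
        square_integrable_band_synthesis_fun eq)
qed

lemma norm_band_synthesis_le: "norm (band_synthesis g) \<le> norm g"
proof -
  have "(norm (band_synthesis g))\<^sup>2 * 1 \<le> (norm (band_synthesis g))\<^sup>2 * (2 * pi)"
    using pi_ge_two by (intro mult_left_mono) auto
  also have "\<dots> = (norm (trunc pi g))\<^sup>2"
    using norm_band_synthesis[of g] by (simp add: mult_ac)
  also have "\<dots> \<le> (norm g)\<^sup>2"
    by (intro power_mono norm_trunc_le) auto
  finally show ?thesis
    by (intro power2_le_imp_le[of "norm (band_synthesis g)" "norm g"]) auto
qed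

lemma bounded_linear_band_synthesis: "bounded_linear band_synthesis"
  by (rule bounded_linear_intro[where K = 1])
    (auto simp: band_synthesis_add scaleR_L2_def band_synthesis_scaleC norm_band_synthesis_le)

text \<open>Up to the factor \<open>2 \<pi>\<close>, synthesis is the adjoint of the transform: Fubini, applicable because both
  functions are truncated and hence integrable.\<close>

lemma cinner_trunc_fourier:
  "cinner (trunc_fourier R f) (trunc pi g) = 2 * pi * cinner (trunc R f) (band_synthesis g)"
proof (cases f)
  case f: (1 u)
  show ?thesis
  proof (cases g)
    case g: (1 v)
    define p q where "p t = indicator {-R..R} t * u t" and "q \<xi> = indicator {-pi..pi} \<xi> * v \<xi>" for t \<xi>
    have pq: "integrable lborel p" "integrable lborel q"
      unfolding p_def q_def using f g by (auto intro!: integrable_trunc)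
    then have [measurable]: "p \<in> borel_measurable borel" "q \<in> borel_measurable borel"
      by (auto dest: borel_measurable_integrable)
    have pq2: "square_integrable p" "square_integrable q"
      unfolding p_def q_def using f g by (auto intro!: square_integrable_indicator_mult)
    define k where "k t \<xi> = p t * cnj (q \<xi>) * exp (- (\<i> * of_real (\<xi> * t)))" for t \<xi>
    have [measurable]: "cnj \<in> borel_measurable borel"
      by (intro borel_measurable_continuous_onI continuous_intros)
    have k: "integrable (lborel \<Otimes>\<^sub>M lborel) (\<lambda>(t, \<xi>). k t \<xi>)"
    proof (rule lborel_pair.Fubini_integrable)
      show "(\<lambda>(t, \<xi>). k t \<xi>) \<in> borel_measurable (lborel \<Otimes>\<^sub>M lborel)"
        unfolding k_def by measurable
      have "norm (k t \<xi>) = cmod (p t) * cmod (q \<xi>)" for t \<xi>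
        by (simp add: k_def norm_mult)
      then show "integrable lborel (\<lambda>t. LINT \<xi>|lborel. norm (case (t, \<xi>) of (t, \<xi>) \<Rightarrow> k t \<xi>))"
        using pq by simp
      have "integrable lborel (\<lambda>\<xi>. k t \<xi>)" for t
        unfolding k_def using pq
        by (intro integrable_mult_bounded_continuous[where f = "\<lambda>\<xi>. p t * cnj (q \<xi>)" and B = 1])
          (auto intro!: continuous_intros)
      then show "AE t in lborel. integrable lborel (\<lambda>\<xi>. case (t, \<xi>) of (t, \<xi>) \<Rightarrow> k t \<xi>)"
        by simp
    qed
    have "cinner (trunc_fourier R f) (trunc pi g) = (LINT \<xi>|lborel. fourier_integral p \<xi> * cnj (q \<xi>))"
      using f g pq2 by (simp add: trunc_fourier.abs_eq trunc_abs_L2 p_def[abs_def] q_def[abs_def]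
          cinner_abs_L2 square_integrable_fourier_integral_trunc)
    also have "\<dots> = (LINT \<xi>|lborel. LINT t|lborel. k t \<xi>)"
      unfolding fourier_integral_def k_def
      by (intro Bochner_Integration.integral_cong refl, subst Bochner_Integration.integral_mult_left_zero[symmetric])
        (simp add: mult_ac)
    also have "\<dots> = (LINT t|lborel. LINT \<xi>|lborel. k t \<xi>)"
      using k by (rule lborel_pair.Fubini_integral)
    also have "\<dots> = (LINT t|lborel. 2 * pi * (p t * cnj (band_synthesis_fun v t)))"
    proof (intro Bochner_Integration.integral_cong refl)
      fix t
      have "(LINT \<xi>|lborel. k t \<xi>) = (LINT \<xi>|lborel. p t * cnj (q \<xi> * exp (- (\<i> * of_real ((- t) * \<xi>)))))"
        unfolding k_def by (intro Bochner_Integration.integral_cong refl) (simp add: exp_cnj mult_ac)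
      also have "\<dots> = p t * cnj (fourier_integral q (- t))"
        unfolding fourier_integral_def Bochner_Integration.integral_cnj[symmetric]
        by (rule Bochner_Integration.integral_mult_right_zero)
      finally show "(LINT \<xi>|lborel. k t \<xi>) = 2 * pi * (p t * cnj (band_synthesis_fun v t))"
        unfolding band_synthesis_fun_def q_def[abs_def] by simp
    qed
    also have "\<dots> = 2 * pi * (LINT t|lborel. p t * cnj (band_synthesis_fun v t))"
      by (rule Bochner_Integration.integral_mult_right_zero)
    also have "\<dots> = 2 * pi * cinner (trunc R f) (band_synthesis g)"
      using f g pq2 square_integrable_band_synthesis_fun[OF g(1)]
      by (simp add: band_synthesis_abs_L2 trunc_abs_L2 p_def[abs_def] cinner_abs_L2)
    finally show ?thesis .
  qed
qed

lemma abs_L2_eq_iff: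
  "square_integrable f \<Longrightarrow> square_integrable g \<Longrightarrow> abs_L2 f = abs_L2 g \<longleftrightarrow> (AE x in lborel. f x = g x)"
  using Quotient_rel[OF Quotient_L2, of f g] by (auto simp: L2_eq_def)

lemma tendsto_norm_diff_sq_iff:
  fixes f :: "'i \<Rightarrow> 'a :: real_normed_vector"
  shows "((\<lambda>x. (norm (f x - l))\<^sup>2) \<longlongrightarrow> 0) F \<longleftrightarrow> (f \<longlongrightarrow> l) F"
proof
  assume "((\<lambda>x. (norm (f x - l))\<^sup>2) \<longlongrightarrow> 0) F"
  then have "((\<lambda>x. sqrt ((norm (f x - l))\<^sup>2)) \<longlongrightarrow> sqrt 0) F"
    by (rule tendsto_real_sqrt)
  then show "(f \<longlongrightarrow> l) F"
    by (simp add: tendsto_norm_zero_iff LIM_zero_iff)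
next
  assume "(f \<longlongrightarrow> l) F"
  then have "((\<lambda>x. (norm (f x - l))\<^sup>2) \<longlongrightarrow> (norm (l - l))\<^sup>2) F"
    by (intro tendsto_intros)
  then show "((\<lambda>x. (norm (f x - l))\<^sup>2) \<longlongrightarrow> 0) F" by simp
qed

lemma has_fourier_transform_iff_tendsto: "f has_fourier_transform g \<longleftrightarrow> ((\<lambda>R. trunc_fourier R f) \<longlongrightarrow> g) at_top"
proof (cases f)
  case f: (1 u)
  show ?thesis
  proof (cases g)
    case g: (1 v)
    have "f has_fourier_transform g \<longleftrightarrow> ((\<lambda>R. ennreal ((norm (trunc_fourier R f - g))\<^sup>2)) \<longlongrightarrow> 0) at_top"
      using f g abs_L2_diff[OF square_integrable_fourier_integral_trunc[OF f(1)] g(1)]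
        nn_integral_abs_L2[OF square_integrable_diff[OF square_integrable_fourier_integral_trunc[OF f(1)] g(1)]]
      by (simp add: has_fourier_transform.abs_eq trunc_fourier.abs_eq)
    also have "\<dots> \<longleftrightarrow> ((\<lambda>R. (norm (trunc_fourier R f - g))\<^sup>2) \<longlongrightarrow> 0) at_top"
      unfolding ennreal_0[symmetric] by (rule tendsto_ennreal_iff) simp_all
    also have "\<dots> \<longleftrightarrow> ((\<lambda>R. trunc_fourier R f) \<longlongrightarrow> g) at_top"
      by (rule tendsto_norm_diff_sq_iff)
    finally show ?thesis .
  qed
qed

lemma tendsto_norm_trunc: "((\<lambda>R. (norm (trunc R f))\<^sup>2) \<longlongrightarrow> (norm f)\<^sup>2) at_top"
proof (cases f)
  case (1 h)
  have [measurable]: "h \<in> borel_measurable borel"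
    using 1 by (simp add: square_integrable_def)
  have i: "square_integrable (\<lambda>x. indicator {-R..R} x * h x)" for R
    using 1 by (intro square_integrable_indicator_mult) auto
  have "((\<lambda>R. LINT x|lborel. (cmod (indicator {-R..R} x * h x))\<^sup>2) \<longlongrightarrow> (LINT x|lborel. (cmod (h x))\<^sup>2)) at_top"
  proof (rule integral_dominated_convergence_at_top[where w = "\<lambda>x. (cmod (h x))\<^sup>2"])
    show "AE x in lborel. ((\<lambda>R. (cmod (indicator {-R..R} x * h x))\<^sup>2) \<longlongrightarrow> (cmod (h x))\<^sup>2) at_top"
    proof (rule AE_I2)
      fix x :: real
      have "\<forall>\<^sub>F R in at_top. (cmod (indicator {-R..R} x * h x))\<^sup>2 = (cmod (h x))\<^sup>2"
        using eventually_ge_at_top[of "\<bar>x\<bar>"] by eventually_elim (auto split: split_indicator)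
      then show "((\<lambda>R. (cmod (indicator {-R..R} x * h x))\<^sup>2) \<longlongrightarrow> (cmod (h x))\<^sup>2) at_top"
        by (rule tendsto_eventually)
    qed
    show "integrable lborel (\<lambda>x. (cmod (h x))\<^sup>2)"
      using 1 by (simp add: square_integrable_def)
    show "\<forall>\<^sub>F R in at_top. AE x in lborel. norm ((cmod (indicator {-R..R} x * h x))\<^sup>2) \<le> (cmod (h x))\<^sup>2"
      by (auto split: split_indicator)
  qed measurable
  then show ?thesis
    by (simp only: 1(2) trunc_abs_L2[OF 1(1)] norm_abs_L2[OF i] norm_abs_L2[OF 1(1)])
qed

lemma cinner_trunc_self: "Re (cinner (trunc R f) f) = (norm (trunc R f))\<^sup>2"
proof (cases f)
  case (1 h)
  have i: "square_integrable (\<lambda>x. indicator {-R..R} x * h x)"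
    using 1 by (intro square_integrable_indicator_mult) auto
  have "cinner (trunc R f) f = (LINT x|lborel. indicator {-R..R} x * h x * cnj (h x))"
    using 1 i by (simp add: trunc_abs_L2 cinner_abs_L2)
  also have "\<dots> = (LINT x|lborel. (indicator {-R..R} x * h x) * cnj (indicator {-R..R} x * h x))"
    by (intro Bochner_Integration.integral_cong) (auto split: split_indicator)
  also have "\<dots> = cinner (trunc R f) (trunc R f)"
    using 1 i by (simp add: trunc_abs_L2 cinner_abs_L2)
  finally show ?thesis
    by (simp add: cinner_norm)
qed

text \<open>Fourier inversion for band-limited functions. With \<open>f = band_synthesis g\<close>, the adjoint relation and
  Plancherel evaluate all three terms of the squared distance between \<open>trunc_fourier R f\<close> and \<open>trunc pi g\<close>; it is
  \<open>2 \<pi>\<close> times the squared norm that the truncation of \<open>f\<close> to \<open>[-R, R]\<close> loses.\<close>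

theorem band_synthesis_has_fourier_transform: "band_synthesis g has_fourier_transform trunc pi g"
proof -
  define f where "f = band_synthesis g"
  have "(norm (trunc_fourier R f - trunc pi g))\<^sup>2 = 2 * pi * ((norm f)\<^sup>2 - (norm (trunc R f))\<^sup>2)" for R
  proof -
    have "Re (cinner (trunc_fourier R f) (trunc pi g)) = 2 * pi * Re (cinner (trunc R f) f)"
      unfolding cinner_trunc_fourier by (simp add: f_def)
    then show ?thesis
      unfolding norm_diff_sq norm_trunc_fourier cinner_trunc_self
      by (simp add: f_def norm_band_synthesis[symmetric] algebra_simps)
  qed
  moreover have "((\<lambda>R. 2 * pi * ((norm f)\<^sup>2 - (norm (trunc R f))\<^sup>2)) \<longlongrightarrow> 2 * pi * ((norm f)\<^sup>2 - (norm f)\<^sup>2)) at_top"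
    by (intro tendsto_intros tendsto_norm_trunc)
  ultimately have "((\<lambda>R. (norm (trunc_fourier R f - trunc pi g))\<^sup>2) \<longlongrightarrow> 0) at_top"
    by simp
  then have "((\<lambda>R. trunc_fourier R f) \<longlongrightarrow> trunc pi g) at_top"
    unfolding tendsto_norm_diff_sq_iff .
  then show ?thesis
    by (simp add: has_fourier_transform_iff_tendsto f_def)
qed

text \<open>By Plancherel the truncations of \<open>f - g\<close> have norms tending to \<open>0\<close>, but these norms increase to that
  of \<open>f - g\<close>.\<close>

lemma has_fourier_transform_inject:
  assumes "f has_fourier_transform h" "g has_fourier_transform h"
  shows "f = g"
proof -
  have "((\<lambda>R. (norm (trunc_fourier R (f - g)))\<^sup>2) \<longlongrightarrow> (norm (h - h))\<^sup>2) at_top"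
    using assms unfolding has_fourier_transform_iff_tendsto trunc_fourier_diff
    by (intro tendsto_power tendsto_norm tendsto_diff)
  then have "((\<lambda>R. 2 * pi * (norm (trunc R (f - g)))\<^sup>2) \<longlongrightarrow> 0) at_top"
    by (simp add: norm_trunc_fourier)
  moreover have "((\<lambda>R. 2 * pi * (norm (trunc R (f - g)))\<^sup>2) \<longlongrightarrow> 2 * pi * (norm (f - g))\<^sup>2) at_top"
    by (intro tendsto_intros tendsto_norm_trunc)
  ultimately have "2 * pi * (norm (f - g))\<^sup>2 = 0"
    by (intro tendsto_unique[OF _ _ ]) auto
  then show ?thesis by simp
qed


section \<open>The Paley-Wiener space\<close>

text \<open>Every point off \<open>[-\<pi>, \<pi>]\<close> has a neighbourhood on which \<open>g\<close> vanishes almost everywhere; by Lindelof's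
  theorem countably many of them suffice, so the exceptional null sets add up to a null set.\<close>

lemma ess_support_subset_iff: "ess_support g \<subseteq> {-pi..pi} \<longleftrightarrow> trunc pi g = g"
proof (cases g)
  case (1 v)
  have [measurable]: "v \<in> borel_measurable borel"
    using 1 by (simp add: square_integrable_def)
  have "trunc pi g = g \<longleftrightarrow> (AE x in lborel. indicator {-pi..pi} x * v x = v x)"
    using 1 square_integrable_indicator_mult[OF 1(1), of "{-pi..pi}"]
    by (simp add: trunc_abs_L2 abs_L2_eq_iff)
  moreover have "ess_support g \<subseteq> {-pi..pi} \<longleftrightarrow> (AE x in lborel. indicator {-pi..pi} x * v x = v x)"
  proof
    assume supp: "ess_support g \<subseteq> {-pi..pi}"
    define \<F> where "\<F> = {S :: real set. open S \<and> (AE y in lborel. y \<in> S \<longrightarrow> v y = 0)}"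
    obtain \<F>' where F': "\<F>' \<subseteq> \<F>" "countable \<F>'" "\<Union>\<F>' = \<Union>\<F>"
      by (rule Lindelof[of \<F>]) (auto simp: \<F>_def)
    have cover: "x \<in> \<Union>\<F>" if "x \<notin> {-pi..pi}" for x
    proof -
      have "x \<notin> ess_support g" using that supp by blast
      then obtain e where e: "e > 0" "AE y in lborel. dist y x < e \<longrightarrow> v y = 0"
        using 1 by (auto simp: ess_support.abs_eq)
      then have "ball x e \<in> \<F>"
        by (simp add: \<F>_def dist_commute)
      then show ?thesis using e(1) by (meson UnionI centre_in_ball)
    qed
    have "AE y in lborel. \<forall>S\<in>\<F>'. y \<in> S \<longrightarrow> v y = 0"
      using F' by (intro AE_ball_countable[THEN iffD2]) (auto simp: \<F>_def)
    then show "AE x in lborel. indicator {-pi..pi} x * v x = v x"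
    proof eventually_elim
      case (elim x)
      then show ?case
        using cover[of x] F'(3) by (cases "x \<in> {-pi..pi}") auto
    qed
  next
    assume ae: "AE x in lborel. indicator {-pi..pi} x * v x = v x"
    show "ess_support g \<subseteq> {-pi..pi}"
    proof (rule subsetI, rule ccontr)
      fix x assume x: "x \<in> ess_support g" "x \<notin> {-pi..pi}"
      have "open (- {-pi..pi})" by (intro open_Compl) simp
      then obtain e where e: "e > 0" "\<And>y. dist y x < e \<Longrightarrow> y \<in> - {-pi..pi}"
        using x(2) unfolding open_dist by blast
      have "AE y in lborel. dist y x < e \<longrightarrow> v y = 0"
        using ae
      proof eventually_elim
        case (elim y)
        then show ?case using e(2)[of y] by (auto split: split_indicator)
      qed
      then show False using x(1) e(1) 1 by (auto simp: ess_support.abs_eq)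
    qed
  qed
  ultimately show ?thesis by simp
qed

lemma trunc_trunc: "trunc R (trunc R g) = trunc R g"
proof (cases g)
  case (1 v)
  have eq: "(\<lambda>\<xi>. indicator {-R..R} \<xi> * (indicator {-R..R} \<xi> * v \<xi>)) = (\<lambda>\<xi>. indicator {-R..R} \<xi> * v \<xi>)"
    by (auto simp: fun_eq_iff split: split_indicator)
  have i: "square_integrable (\<lambda>x. indicator {-R..R} x * v x)"
    using 1 by (intro square_integrable_indicator_mult) auto
  show ?thesis
    unfolding 1(2) trunc_abs_L2[OF 1(1)] trunc_abs_L2[OF i] eq ..
qed

lemma band_synthesis_trunc: "band_synthesis (trunc pi g) = band_synthesis g"
proof -
  have "trunc pi (g - trunc pi g) = 0"
    using trunc_add[of pi "g - trunc pi g" "trunc pi g"] by (simp add: trunc_trunc)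
  then have "norm (band_synthesis (g - trunc pi g)) = 0"
    using norm_band_synthesis[of "g - trunc pi g"] by simp
  then show ?thesis
    using band_synthesis_add[of "g - trunc pi g" "trunc pi g"] by simp
qed

text \<open>If \<open>f\<close> has a transform \<open>g\<close> supported in \<open>[-\<pi>, \<pi>]\<close>, then so does \<open>band_synthesis g\<close>, and a function
  is determined by its transform.\<close>

theorem paley_wiener_space_eq_range_band_synthesis: "paley_wiener_space = range band_synthesis"
proof (intro equalityI subsetI)
  fix f assume "f \<in> paley_wiener_space"
  then obtain g where g: "f has_fourier_transform g" "trunc pi g = g"
    by (auto simp: paley_wiener_space_def ess_support_subset_iff)
  then have "f = band_synthesis g"
    using has_fourier_transform_inject band_synthesis_has_fourier_transform[of g] by simp
  then show "f \<in> range band_synthesis" by simp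
next
  fix f assume "f \<in> range band_synthesis"
  then obtain g where "f = band_synthesis g" by auto
  then show "f \<in> paley_wiener_space"
    using band_synthesis_has_fourier_transform[of g]
    by (auto simp: paley_wiener_space_def ess_support_subset_iff trunc_trunc)
qed

lemma subspace_paley_wiener_space: "L2.subspace paley_wiener_space"
  unfolding paley_wiener_space_eq_range_band_synthesis
proof (rule L2.subspaceI)
  show "0 \<in> range band_synthesis"
    using band_synthesis_scaleC[of 0 0] by (metis L2.scale_zero_left rangeI)
  show "x + y \<in> range band_synthesis" if "x \<in> range band_synthesis" "y \<in> range band_synthesis" for x y
    using that by (auto simp flip: band_synthesis_add)
  show "scaleC c x \<in> range band_synthesis" if "x \<in> range band_synthesis" for c x
    using that by (auto simp flip: band_synthesis_scaleC)
qed

text \<open>Synthesis is a multiple of an isometry on the complete space of functions supported in \<open>[-\<pi>, \<pi>]\<close>.\<close>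

lemma closed_paley_wiener_space: "closed paley_wiener_space"
proof -
  define B where "B = {g. trunc pi g = g}"
  have "closed B"
    unfolding B_def
    by (intro closed_Collect_eq linear_continuous_on bounded_linear_trunc continuous_intros)
  then have "complete B" by (simp add: complete_eq_closed)
  moreover have "subspace B"
    using bounded_linear_trunc[of pi, THEN bounded_linear.linear]
    by (auto simp: subspace_def B_def linear_add linear_scale linear_0)
  moreover have "norm (band_synthesis g) \<ge> 1 / sqrt (2 * pi) * norm g" if "g \<in> B" for g
    using that norm_band_synthesis_supported[of g] by (simp add: B_def)
  ultimately have "complete (band_synthesis ` B)"
    by (intro complete_isometric_image[where e = "1 / sqrt (2 * pi)"] bounded_linear_band_synthesis) auto
  moreover have "band_synthesis ` B = range band_synthesis"
    using band_synthesis_trunc trunc_trunc by (auto simp: B_def image_iff) metis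
  ultimately show ?thesis
    by (simp add: paley_wiener_space_eq_range_band_synthesis complete_eq_closed)
qed

lemma csinc_minus: "csinc (- z) = csinc z"
  by (simp add: csinc_def)

lemma band_synthesis_band_exp: "band_synthesis (band_exp w) = sinc_L2 w"
proof -
  have "band_synthesis_fun (\<lambda>\<xi>. indicator {-pi..pi} \<xi> * exp (- (\<i> * w * of_real \<xi>))) t = csinc (w - of_real t)" for t
  proof -
    have "fourier_integral (\<lambda>\<xi>. indicator {-pi..pi} \<xi> *
        (indicator {-pi..pi} \<xi> * exp (- (\<i> * w * of_real \<xi>)))) (- t)
      = (LINT \<xi>|lborel. indicator {-pi..pi} \<xi> * exp (\<i> * (of_real t - w) * of_real \<xi>))"
      unfolding fourier_integral_def
      by (intro Bochner_Integration.integral_cong refl)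
        (auto simp: algebra_simps simp flip: exp_add split: split_indicator)
    also have "\<dots> = 2 * pi * csinc (w - of_real t)"
      using csinc_minus[of "w - of_real t"] by (simp add: integral_exp_csinc)
    finally show ?thesis by (simp add: band_synthesis_fun_def)
  qed
  then have "band_synthesis_fun (\<lambda>\<xi>. indicator {-pi..pi} \<xi> * exp (- (\<i> * w * of_real \<xi>))) = (\<lambda>t. csinc (w - of_real t))"
    by (rule ext)
  then show ?thesis
    unfolding band_exp.abs_eq sinc_L2.abs_eq band_synthesis_abs_L2[OF square_integrable_band_exp] by (rule arg_cong)
qed

lemma sinc_L2_in_paley_wiener_space: "sinc_L2 w \<in> paley_wiener_space"
  unfolding paley_wiener_space_eq_range_band_synthesis band_synthesis_band_exp[symmetric] by simp

text \<open>Polarization. The imaginary part is the real part for \<open>\<i> g\<close> in place of \<open>g\<close>.\<close>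

lemma cinner_band_synthesis: "2 * pi * cinner (band_synthesis f) (band_synthesis g) = cinner (trunc pi f) (trunc pi g)"
proof -
  have re: "2 * pi * Re (cinner (band_synthesis f) (band_synthesis g)) = Re (cinner (trunc pi f) (trunc pi g))" for f g
    using norm_band_synthesis[of "f + g"] norm_band_synthesis[of f] norm_band_synthesis[of g]
    unfolding band_synthesis_add trunc_add norm_add_sq by (simp add: algebra_simps)
  have "2 * pi * Im (cinner (band_synthesis f) (band_synthesis g)) = Im (cinner (trunc pi f) (trunc pi g))"
    using re[of f "scaleC \<i> g"] by (simp add: band_synthesis_scaleC trunc_scaleC cinner_scaleC_right)
  with re[of f g] show ?thesis
    by (simp add: complex_eq_iff)
qed

text \<open>The expansion in exponentials of the transform is carried to an expansion in translates of sinc.\<close>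

theorem orthonormal_basis_sinc: "orthonormal_basis_of paley_wiener_space (\<lambda>n::int. sinc_L2 (of_int n))"
  unfolding orthonormal_basis_of_def
proof (intro conjI allI)
  show "range (\<lambda>n::int. sinc_L2 (of_int n)) \<subseteq> paley_wiener_space"
    by (auto simp: sinc_L2_in_paley_wiener_space)
  show "cinner (sinc_L2 (of_int m)) (sinc_L2 (of_int n)) = (if m = n then 1 else 0)" for m n :: int
    using cinner_band_synthesis[of "band_exp (of_int m)" "band_exp (of_int n)"] csinc_of_int[of "n - m"]
    by (simp add: band_synthesis_band_exp trunc_band_exp cinner_band_exp)
  show "paley_wiener_space \<subseteq> closure (L2.span (range (\<lambda>n::int. sinc_L2 (of_int n))))"
  proof
    fix f assume "f \<in> paley_wiener_space"
    then obtain g where g: "f = band_synthesis (trunc pi g)"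
      by (auto simp: paley_wiener_space_eq_range_band_synthesis band_synthesis_trunc)
    have "((\<lambda>n. band_synthesis (scaleC (cinner (trunc pi g) (trig_basis n)) (trig_basis n))) has_sum f) UNIV"
      unfolding g by (intro has_sum_bounded_linear[OF bounded_linear_band_synthesis trig_expansion] trunc_trunc)
    then have "((\<lambda>n. scaleC (cinner (trunc pi g) (trig_basis n) * of_real (1 / sqrt (2 * pi))) (sinc_L2 (of_int n))) has_sum f) UNIV"
      by (simp add: band_synthesis_scaleC trig_basis_def band_synthesis_band_exp)
    then show "f \<in> closure (L2.span (range (\<lambda>n::int. sinc_L2 (of_int n))))"
      by (rule has_sum_in_closure_span)
  qed
qed


section \<open>Perturbed exponentials\<close>

lemma exp_sums_divide_fact:
  "(\<lambda>k. z ^ k / fact k) sums exp (z :: 'a :: {real_normed_field, banach})"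
  using exp_converges[of z] by (simp add: scaleR_conv_of_real divide_inverse mult.commute)

lemma norm_exp_remainder_le:
  fixes z :: complex
  assumes "cmod z \<le> r"
  shows "cmod (exp z - (\<Sum>k<K. z ^ k / fact k)) \<le> exp r - (\<Sum>k<K. r ^ k / fact k)"
proof (rule norm_sums_le)
  show "(\<lambda>k. z ^ (k + K) / fact (k + K)) sums (exp z - (\<Sum>k<K. z ^ k / fact k))"
    by (rule sums_split_initial_segment[OF exp_sums_divide_fact])
  show "(\<lambda>k. r ^ (k + K) / fact (k + K)) sums (exp r - (\<Sum>k<K. r ^ k / fact k))"
    by (rule sums_split_initial_segment[OF exp_sums_divide_fact])
  show "cmod (z ^ (k + K) / fact (k + K)) \<le> r ^ (k + K) / fact (k + K)" for k
    using assms by (auto simp: norm_divide norm_power intro!: divide_right_mono power_mono)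
qed

lemma norm_abs_L2_le:
  assumes "square_integrable f" "\<And>x. x \<notin> {-pi..pi} \<Longrightarrow> f x = 0" "\<And>x. x \<in> {-pi..pi} \<Longrightarrow> cmod (f x) \<le> e"
  shows "norm (abs_L2 f) \<le> sqrt (2 * pi) * e"
proof -
  have e: "0 \<le> e"
    using order_trans[OF norm_ge_zero assms(3)[of 0]] by simp
  have "integrable lborel (\<lambda>x. indicator {-pi..pi} x *\<^sub>R (e\<^sup>2))"
    using borel_integrable_atLeastAtMost'[of "-pi" pi "\<lambda>x. e\<^sup>2"] by (simp add: set_integrable_def)
  then have "(LINT x|lborel. (cmod (f x))\<^sup>2) \<le> (LINT x|lborel. indicator {-pi..pi} x *\<^sub>R (e\<^sup>2))"
    using assms by (intro integral_mono)
      (auto simp: square_integrable_def intro!: power_mono split: split_indicator)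
  also have "\<dots> = 2 * pi * e\<^sup>2"
    by simp
  finally have "(norm (abs_L2 f))\<^sup>2 \<le> (sqrt (2 * pi) * e)\<^sup>2"
    using norm_abs_L2[OF assms(1)] by (simp add: power_mult_distrib)
  then show ?thesis
    by (rule power2_le_imp_le) (use e in simp)
qed

lemma square_integrable_mult_power:
  assumes "square_integrable f"
  shows "square_integrable (\<lambda>\<xi>. indicator {-pi..pi} \<xi> * of_real (\<xi> ^ k) * f \<xi>)"
    and "(cmod (indicator {-pi..pi} \<xi> * of_real (\<xi> ^ k) * f \<xi>))\<^sup>2 \<le> (pi ^ k)\<^sup>2 * (cmod (f \<xi>))\<^sup>2"
proof -
  show le: "(cmod (indicator {-pi..pi} \<xi> * of_real (\<xi> ^ k) * f \<xi>))\<^sup>2 \<le> (pi ^ k)\<^sup>2 * (cmod (f \<xi>))\<^sup>2" for \<xi>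
    unfolding power_mult_distrib[symmetric]
    by (intro power_mono) (auto simp: norm_mult norm_power intro!: mult_right_mono power_mono split: split_indicator)
  have [measurable]: "f \<in> borel_measurable borel"
    using assms by (simp add: square_integrable_def)
  have "integrable lborel (\<lambda>\<xi>. (pi ^ k)\<^sup>2 * (cmod (f \<xi>))\<^sup>2)"
    using assms by (simp add: square_integrable_def)
  then have "integrable lborel (\<lambda>\<xi>. (cmod (indicator {-pi..pi} \<xi> * of_real (\<xi> ^ k) * f \<xi>))\<^sup>2)"
    by (rule Bochner_Integration.integrable_bound) (use le in \<open>auto\<close>)
  then show "square_integrable (\<lambda>\<xi>. indicator {-pi..pi} \<xi> * of_real (\<xi> ^ k) * f \<xi>)"
    by (simp add: square_integrable_def)
qed

text \<open>The cutoff makes multiplication by \<open>\<xi>\<^sup>k\<close> a bounded operator.\<close>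

lift_definition mult_power :: "nat \<Rightarrow> L2 \<Rightarrow> L2" is
  "\<lambda>k f \<xi>. indicator {-pi..pi} \<xi> * of_real (\<xi> ^ k) * f \<xi>"
  unfolding L2_eq_def by (auto simp: square_integrable_mult_power simp del: of_real_power)

lemma mult_power_abs_L2:
  "square_integrable f \<Longrightarrow> mult_power k (abs_L2 f) = abs_L2 (\<lambda>\<xi>. indicator {-pi..pi} \<xi> * of_real (\<xi> ^ k) * f \<xi>)"
  by (simp add: mult_power.abs_eq)

lemma norm_mult_power_le: "norm (mult_power k f) \<le> pi ^ k * norm f"
proof (cases f)
  case (1 h)
  have "(norm (mult_power k f))\<^sup>2 \<le> (pi ^ k * norm f)\<^sup>2"
    unfolding 1(2) mult_power_abs_L2[OF 1(1)] norm_abs_L2[OF square_integrable_mult_power(1)[OF 1(1)]]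
      power_mult_distrib norm_abs_L2[OF 1(1)]
    unfolding Bochner_Integration.integral_mult_right_zero[symmetric]
    using 1(1) square_integrable_mult_power(1)[OF 1(1), of k] square_integrable_mult_power(2)[OF 1(1), of _ k]
    by (intro integral_mono) (auto simp: square_integrable_def)
  then show ?thesis by (rule power2_le_imp_le) simp
qed

lemma mult_power_add: "mult_power k (f + g) = mult_power k f + mult_power k g"
  by transfer (auto simp: L2_eq_def distrib_left simp del: of_real_power
    intro!: square_integrable_add square_integrable_mult_power)

lemma mult_power_scaleC: "mult_power k (scaleC c f) = scaleC c (mult_power k f)"
  by transfer (auto simp: L2_eq_def mult.left_commute simp del: of_real_power
    intro!: square_integrable_scale square_integrable_mult_power)

lemma mult_power_sum: "mult_power k (\<Sum>n\<in>A. f n) = (\<Sum>n\<in>A. mult_power k (f n))"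
proof -
  have "mult_power k 0 = 0" using mult_power_scaleC[of k 0 0] by simp
  then show ?thesis
    by (induction A rule: infinite_finite_induct) (auto simp: mult_power_add)
qed

lemma mult_power_0_band_exp: "mult_power 0 (band_exp w) = band_exp w"
  unfolding band_exp.abs_eq mult_power_abs_L2[OF square_integrable_band_exp]
  by (rule arg_cong[of _ _ abs_L2]) (auto split: split_indicator)

lemma sum_abs_L2:
  "(\<And>k. k \<in> A \<Longrightarrow> square_integrable (f k)) \<Longrightarrow> finite A \<Longrightarrow>
    square_integrable (\<lambda>x. \<Sum>k\<in>A. f k x) \<and> (\<Sum>k\<in>A. abs_L2 (f k)) = abs_L2 (\<lambda>x. \<Sum>k\<in>A. f k x)"
  by (induction A rule: infinite_finite_induct)
    (auto simp: square_integrable_0 zero_L2_def square_integrable_add plus_L2.abs_eq)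

text \<open>The Taylor expansion of \<open>exp (- \<i> \<delta> \<xi>)\<close> converges uniformly for \<open>\<xi>\<close> in \<open>[-\<pi>, \<pi>]\<close>, hence in
  \<open>L\<^sup>2[-\<pi>, \<pi>]\<close>. For real \<open>w\<close> the remaining factor \<open>exp (- \<i> w \<xi>)\<close> has modulus \<open>1\<close>.\<close>

lemma band_exp_add_sums:
  assumes "Im w = 0"
  shows "(\<lambda>k. scaleC ((- (\<i> * \<delta>)) ^ k / fact k) (mult_power k (band_exp w))) sums band_exp (w + \<delta>)"
  unfolding sums_def
proof -
  define r where "r = pi * cmod \<delta>"
  define u where "u \<xi> = indicator {-pi..pi} \<xi> * exp (- (\<i> * w * of_real \<xi>))" for \<xi>
  define v where "v k \<xi> = (- (\<i> * \<delta>)) ^ k / fact k * (indicator {-pi..pi} \<xi> * of_real (\<xi> ^ k) * u \<xi>)" for k \<xi>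
  have u: "square_integrable u"
    unfolding u_def by (rule square_integrable_band_exp)
  have v: "square_integrable (v k)" for k
    unfolding v_def by (intro square_integrable_scale square_integrable_mult_power u)
  have vk: "scaleC ((- (\<i> * \<delta>)) ^ k / fact k) (mult_power k (band_exp w)) = abs_L2 (v k)" for k
    using u square_integrable_mult_power(1)[OF u]
    by (simp add: band_exp.abs_eq mult_power_abs_L2 scaleC.abs_eq v_def[abs_def] flip: u_def del: of_real_power)
  have remainder: "norm ((\<Sum>k<K. abs_L2 (v k)) - band_exp (w + \<delta>)) \<le> sqrt (2 * pi) * (exp r - (\<Sum>k<K. r ^ k / fact k))" for K
  proof -
    define e where "e \<xi> = (\<Sum>k<K. v k \<xi>) - indicator {-pi..pi} \<xi> * exp (- (\<i> * (w + \<delta>) * of_real \<xi>))" for \<xi>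
    have s: "square_integrable (\<lambda>\<xi>. \<Sum>k<K. v k \<xi>)" "(\<Sum>k<K. abs_L2 (v k)) = abs_L2 (\<lambda>\<xi>. \<Sum>k<K. v k \<xi>)"
      using sum_abs_L2[of "{..<K}" v] v by auto
    have "(\<Sum>k<K. abs_L2 (v k)) - band_exp (w + \<delta>) = abs_L2 e"
      unfolding s(2) band_exp.abs_eq e_def by (rule abs_L2_diff[OF s(1) square_integrable_band_exp])
    also have "norm (abs_L2 e) \<le> sqrt (2 * pi) * (exp r - (\<Sum>k<K. r ^ k / fact k))"
    proof (rule norm_abs_L2_le)
      show "square_integrable e"
        unfolding e_def by (rule square_integrable_diff[OF s(1) square_integrable_band_exp])
      show "e \<xi> = 0" if "\<xi> \<notin> {-pi..pi}" for \<xi>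
        using that by (simp add: e_def v_def)
      show "cmod (e \<xi>) \<le> exp r - (\<Sum>k<K. r ^ k / fact k)" if \<xi>: "\<xi> \<in> {-pi..pi}" for \<xi>
      proof -
        define z where "z = - (\<i> * \<delta> * of_real \<xi>)"
        have "v k \<xi> = exp (- (\<i> * w * of_real \<xi>)) * (z ^ k / fact k)" for k
        proof -
          have "z = (- (\<i> * \<delta>)) * of_real \<xi>" by (simp add: z_def)
          then show ?thesis
            using \<xi> by (simp only: power_mult_distrib) (simp add: v_def u_def)
        qed
        then have "e \<xi> = - (exp (- (\<i> * w * of_real \<xi>)) * (exp z - (\<Sum>k<K. z ^ k / fact k)))"
          using \<xi> by (simp add: e_def z_def algebra_simps sum_distrib_left flip: exp_add)
        then have "cmod (e \<xi>) = cmod (exp (- (\<i> * w * of_real \<xi>))) * cmod (exp z - (\<Sum>k<K. z ^ k / fact k))"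
          by (simp only: norm_minus_cancel norm_mult)
        also have "cmod (exp (- (\<i> * w * of_real \<xi>))) = 1"
          using assms by simp
        also have "1 * cmod (exp z - (\<Sum>k<K. z ^ k / fact k)) \<le> exp r - (\<Sum>k<K. r ^ k / fact k)"
        proof -
          have "cmod z \<le> r"
            using \<xi> mult_right_mono[of "\<bar>\<xi>\<bar>" pi "cmod \<delta>"] by (auto simp: z_def r_def norm_mult mult.commute)
          then show ?thesis using norm_exp_remainder_le[of z r K] by simp
        qed
        finally show ?thesis .
      qed
    qed
    finally show ?thesis .
  qed
  have "(\<lambda>K. sqrt (2 * pi) * (exp r - (\<Sum>k<K. r ^ k / fact k))) \<longlonglongrightarrow> sqrt (2 * pi) * (exp r - exp r)"
    using exp_sums_divide_fact[of r] unfolding sums_def by (intro tendsto_intros)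
  then have "(\<lambda>K. sqrt (2 * pi) * (exp r - (\<Sum>k<K. r ^ k / fact k))) \<longlonglongrightarrow> 0"
    by simp
  then have "(\<lambda>K. (\<Sum>k<K. abs_L2 (v k)) - band_exp (w + \<delta>)) \<longlonglongrightarrow> 0"
    by (rule Lim_null_comparison[OF always_eventually[OF allI[OF remainder]]])
  then show "(\<lambda>K. \<Sum>k<K. scaleC ((- (\<i> * \<delta>)) ^ k / fact k) (mult_power k (band_exp w))) \<longlonglongrightarrow> band_exp (w + \<delta>)"
    unfolding vk by (rule LIM_zero_cancel)
qed


lemma norm_sum_band_exp:
  fixes A :: "int set"
  assumes "finite A"
  shows "(norm (\<Sum>n\<in>A. scaleC (a n) (band_exp (of_int n))))\<^sup>2 = 2 * pi * (\<Sum>n\<in>A. (cmod (a n))\<^sup>2)"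
proof -
  have c: "complex_of_real (sqrt (2 * pi)) * of_real (1 / sqrt (2 * pi)) = 1"
    unfolding of_real_mult[symmetric] by simp
  have "band_exp (of_int n) = scaleC (of_real (sqrt (2 * pi))) (trig_basis n)" for n
    unfolding trig_basis_def L2.scale_scale c by simp
  then have "(\<Sum>n\<in>A. scaleC (a n) (band_exp (of_int n))) = scaleC (of_real (sqrt (2 * pi))) (\<Sum>n\<in>A. scaleC (a n) (trig_basis n))"
    by (simp add: L2.scale_sum_right mult.commute)
  then show ?thesis
    by (simp add: power_mult_distrib orthonormal_norm_sum[OF orthonormal_trig_basis assms])
qed

text \<open>The estimate of Duffin and Eachus. In the \<open>k\<close>-th term of the expansion, the powers of the perturbations
  only enter as coefficients of an orthogonal family, and there they can be replaced by the common bound \<open>L\<^sup>k\<close>.\<close>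

theorem norm_perturbed_exponentials_le:
  fixes A :: "int set" and lam :: "int \<Rightarrow> complex"
  assumes A: "finite A" and L: "\<And>n. cmod (lam n - of_int n) \<le> L"
  shows "norm (\<Sum>n\<in>A. scaleC (a n) (band_exp (lam n) - band_exp (of_int n)))
    \<le> (exp (pi * L) - 1) * norm (\<Sum>n\<in>A. scaleC (a n) (band_exp (of_int n)))"
proof -
  define N where "N = norm (\<Sum>n\<in>A. scaleC (a n) (band_exp (of_int n)))"
  define \<delta> where "\<delta> n = lam n - of_int n" for n
  define t where "t k = (\<Sum>n\<in>A. scaleC (a n) (scaleC ((- (\<i> * \<delta> n)) ^ k / fact k) (mult_power k (band_exp (of_int n)))))" for k
  have "L \<ge> 0"
    using order_trans[OF norm_ge_zero L] .
  have "t sums (\<Sum>n\<in>A. scaleC (a n) (band_exp (lam n)))"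
    unfolding t_def
  proof (intro sums_sum bounded_linear.sums[OF bounded_linear_scaleC])
    fix n
    show "(\<lambda>k. scaleC ((- (\<i> * \<delta> n)) ^ k / fact k) (mult_power k (band_exp (of_int n)))) sums band_exp (lam n)"
      using band_exp_add_sums[of "of_int n" "\<delta> n"] by (simp add: \<delta>_def)
  qed
  \<comment> \<open>The term for \<open>k = 0\<close> is the unperturbed sum.\<close>
  then have "(\<lambda>k. t (k + 1)) sums ((\<Sum>n\<in>A. scaleC (a n) (band_exp (lam n))) - (\<Sum>k<1. t k))"
    by (rule sums_split_initial_segment)
  moreover have "(\<Sum>k<1. t k) = (\<Sum>n\<in>A. scaleC (a n) (band_exp (of_int n)))"
    by (simp add: t_def mult_power_0_band_exp)
  ultimately have sums: "(\<lambda>k. t (k + 1)) sums (\<Sum>n\<in>A. scaleC (a n) (band_exp (lam n) - band_exp (of_int n)))"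
    by (simp add: L2.scale_right_diff_distrib sum_subtractf)
  have bound: "norm (t k) \<le> (pi * L) ^ k / fact k * N" for k
  proof -
    define s where "s = (\<Sum>n\<in>A. scaleC (a n * \<delta> n ^ k) (band_exp (of_int n)))"
    have "t k = scaleC ((- \<i>) ^ k / fact k) (mult_power k s)"
    proof -
      have "(- (\<i> * \<delta> n)) ^ k = (- \<i>) ^ k * \<delta> n ^ k" for n
        by (simp flip: power_mult_distrib)
      then show ?thesis
        unfolding t_def s_def mult_power_sum mult_power_scaleC L2.scale_sum_right L2.scale_scale
        by (simp add: mult_ac)
    qed
    then have "norm (t k) = norm (mult_power k s) / fact k"
      by (simp add: norm_divide norm_power)
    also have "\<dots> \<le> (pi ^ k * norm s) / fact k"
      by (intro divide_right_mono norm_mult_power_le) auto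
    also have "norm s \<le> L ^ k * N"
    proof (rule power2_le_imp_le)
      have "(norm s)\<^sup>2 = 2 * pi * (\<Sum>n\<in>A. (cmod (a n * \<delta> n ^ k))\<^sup>2)"
        unfolding s_def by (rule norm_sum_band_exp[OF A])
      also have "\<dots> \<le> 2 * pi * (\<Sum>n\<in>A. (L ^ k)\<^sup>2 * (cmod (a n))\<^sup>2)"
      proof (intro mult_left_mono sum_mono)
        fix n
        have "cmod (a n * \<delta> n ^ k) \<le> L ^ k * cmod (a n)"
          using power_mono[OF L[of n], of k] mult_right_mono[of "cmod (\<delta> n) ^ k" "L ^ k" "cmod (a n)"]
          by (simp add: norm_mult norm_power \<delta>_def mult.commute)
        then show "(cmod (a n * \<delta> n ^ k))\<^sup>2 \<le> (L ^ k)\<^sup>2 * (cmod (a n))\<^sup>2"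
          unfolding power_mult_distrib[symmetric] by (intro power_mono) auto
      qed auto
      also have "\<dots> = (L ^ k * N)\<^sup>2"
        unfolding N_def power_mult_distrib norm_sum_band_exp[OF A] by (simp add: sum_distrib_left mult.left_commute)
      finally show "(norm s)\<^sup>2 \<le> (L ^ k * N)\<^sup>2" .
    qed (use \<open>L \<ge> 0\<close> in \<open>simp add: N_def\<close>)
    finally show ?thesis
      by (simp add: power_mult_distrib mult_left_mono divide_right_mono mult.assoc)
  qed
  have "(\<lambda>k. (pi * L) ^ (k + 1) / fact (k + 1)) sums (exp (pi * L) - (\<Sum>k<1. (pi * L) ^ k / fact k))"
    by (rule sums_split_initial_segment[OF exp_sums_divide_fact])
  then have "(\<lambda>k. (pi * L) ^ (k + 1) / fact (k + 1) * N) sums ((exp (pi * L) - 1) * N)"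
    by (intro sums_mult2) simp
  then show ?thesis
    unfolding N_def[symmetric] by (rule norm_sums_le[OF sums]) (rule bound)
qed


section \<open>The numerical bound\<close>

text \<open>\<open>exp x - 2 x - 1\<close> is positive from \<open>x = 1.28\<close> on; in fact \<open>exp 1.28 = 3.59\<dots>\<close> exceeds
  \<open>2 * 1.28 + 1 = 3.56\<close> and \<open>exp\<close> grows faster than the line.\<close>

lemma lamb_oseen_less: "lamb_oseen < 32 / 25"
proof (rule ccontr)
  assume "\<not> ?thesis"
  then have ge: "32 / 25 \<le> lamb_oseen" by simp
  have \<alpha>: "exp lamb_oseen = 2 * lamb_oseen + 1"
    unfolding lamb_oseen_def using theI'[OF lamb_oseen_ex1] by blast
  \<comment> \<open>The margin is small: with the fourth power, the quadratic Taylor bound for \<open>exp (8/25)\<close> gives only \<open>3.53\<dots>\<close>.\<close>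
  have "(1 + 4/25 + (4/25)\<^sup>2 / 2 :: real) ^ 8 \<le> exp (4/25) ^ 8"
    by (intro power_mono exp_lower_Taylor_quadratic) auto
  also have "\<dots> = exp (32/25)"
    by (simp flip: exp_of_nat_mult)
  finally have "(357 / 100 :: real) \<le> exp (32/25)"
    by (rule order_trans[rotated]) (simp add: power2_eq_square power_divide)
  moreover have "1 + (lamb_oseen - 32/25) \<le> exp (lamb_oseen - 32/25)"
    by (rule exp_ge_add_one_self)
  ultimately have "357 / 100 * (1 + (lamb_oseen - 32/25)) \<le> exp (32/25) * exp (lamb_oseen - 32/25)"
    using ge by (intro mult_mono) auto
  also have "\<dots> = 2 * lamb_oseen + 1"
    by (simp flip: exp_add add: \<alpha>)
  finally show False using ge by simp
qed

text \<open>The first three terms of \<open>ln 2 = 2 artanh (1/3)\<close> give \<open>0.69300\<dots>\<close>.\<close>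

lemma ln_2_ge: "693 / 1000 \<le> ln (2 :: real)"
proof -
  have sums: "(\<lambda>n. 2 * ((2 - 1) / (2 + 1)) ^ (2 * n + 1) / of_nat (2 * n + 1)) sums ln (2 :: real)"
    by (rule ln_series_quadratic) simp
  have "(\<Sum>n<3. 2 * ((2 - 1) / (2 + 1)) ^ (2 * n + 1) / of_nat (2 * n + 1)) \<le> ln (2 :: real)"
    unfolding sums_unique[OF sums]
    by (rule sum_le_suminf[OF sums_summable[OF sums]]) auto
  then show ?thesis
    by (simp add: eval_nat_numeral)
qed

text \<open>\<open>3/8 * 1.28 = 0.48 < 0.480249 = 0.693\<^sup>2\<close>.\<close>

lemma sqrt_lamb_oseen_less: "sqrt (3 * lamb_oseen / 8) < ln 2"
proof -
  have "3 * lamb_oseen / 8 < (693 / 1000)\<^sup>2"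
    using lamb_oseen_less by (simp add: power2_eq_square)
  then have "sqrt (3 * lamb_oseen / 8) < 693 / 1000"
    by (intro real_less_lsqrt) auto
  then show ?thesis using ln_2_ge by simp
qed


section \<open>Perturbed translates of sinc\<close>

theorem theorem3:
  fixes lam :: "int \<Rightarrow> complex" and L :: real
  assumes "\<And>n. cmod (lam n - of_int n) \<le> L"
    and "L < 1 / pi * sqrt (3 * lamb_oseen / 8)"
  shows "paley_wiener_criterion (\<lambda>n::int. sinc_L2 (of_int n)) (\<lambda>n. sinc_L2 (lam n))
    \<and> riesz_basis_of paley_wiener_space (\<lambda>n. sinc_L2 (lam n))"
proof
  have "pi * L < sqrt (3 * lamb_oseen / 8)"
    using assms(2) by (simp add: field_simps)
  then have "pi * L < ln 2"
    using sqrt_lamb_oseen_less by simp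
  then have l1: "exp (pi * L) - 1 < 1"
    using exp_less_mono[of "pi * L" "ln 2"] by simp
  have "0 \<le> L"
    using order_trans[OF norm_ge_zero assms(1)] .
  then have l0: "0 \<le> exp (pi * L) - 1"
    by simp
  have sup: "trunc pi (\<Sum>n\<in>A. scaleC (a n) (f n)) = (\<Sum>n\<in>A. scaleC (a n) (f n))"
    if "\<And>n. trunc pi (f n) = f n" for A :: "int set" and a f
  proof -
    have "trunc pi 0 = 0" using trunc_scaleC[of pi 0 0] by simp
    then show ?thesis
      using that by (induction A rule: infinite_finite_induct) (auto simp: trunc_add trunc_scaleC)
  qed
  have syn: "band_synthesis (\<Sum>n\<in>A. scaleC (a n) (f n)) = (\<Sum>n\<in>A. scaleC (a n) (band_synthesis (f n)))"
    for A :: "int set" and a f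
  proof -
    have "band_synthesis 0 = 0" using band_synthesis_scaleC[of 0 0] by simp
    then show ?thesis
      by (induction A rule: infinite_finite_induct) (auto simp: band_synthesis_add band_synthesis_scaleC)
  qed
  have synd: "band_synthesis (f - g) = band_synthesis f - band_synthesis g" for f g
    using band_synthesis_add[of "f - g" g] by simp
  have trd: "trunc pi (f - g) = trunc pi f - trunc pi g" for f g
    using trunc_add[of pi "f - g" g] by simp
  show criterion: "paley_wiener_criterion (\<lambda>n::int. sinc_L2 (of_int n)) (\<lambda>n. sinc_L2 (lam n))"
    unfolding paley_wiener_criterion_def
  proof (intro exI[of _ "exp (pi * L) - 1"] conjI l0 l1 allI impI)
    fix A :: "int set" and a assume A: "finite A"
    let ?D = "\<Sum>n\<in>A. scaleC (a n) (band_exp (lam n) - band_exp (of_int n))"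
    let ?E = "\<Sum>n\<in>A. scaleC (a n) (band_exp (of_int n))"
    have D: "band_synthesis ?D = - (\<Sum>n\<in>A. scaleC (a n) (sinc_L2 (of_int n) - sinc_L2 (lam n)))"
      unfolding syn synd band_synthesis_band_exp by (simp add: L2.scale_right_diff_distrib sum_subtractf)
    have E: "band_synthesis ?E = (\<Sum>n\<in>A. scaleC (a n) (sinc_L2 (of_int n)))"
      unfolding syn band_synthesis_band_exp ..
    have "norm ?D \<le> (exp (pi * L) - 1) * norm ?E"
      by (rule norm_perturbed_exponentials_le[OF A assms(1)])
    moreover have "norm ?D = sqrt (2 * pi) * norm (band_synthesis ?D)"
      by (intro norm_band_synthesis_supported sup) (simp add: trd trunc_band_exp)
    moreover have "norm ?E = sqrt (2 * pi) * norm (band_synthesis ?E)"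
      by (intro norm_band_synthesis_supported sup trunc_band_exp)
    ultimately have "sqrt (2 * pi) * norm (band_synthesis ?D) \<le> sqrt (2 * pi) * ((exp (pi * L) - 1) * norm (band_synthesis ?E))"
      by (simp add: mult_ac)
    then have "norm (band_synthesis ?D) \<le> (exp (pi * L) - 1) * norm (band_synthesis ?E)"
      by (simp add: mult_le_cancel_left_pos)
    then show "norm (\<Sum>n\<in>A. scaleC (a n) (sinc_L2 (of_int n) - sinc_L2 (lam n)))
        \<le> (exp (pi * L) - 1) * norm (\<Sum>n\<in>A. scaleC (a n) (sinc_L2 (of_int n)))"
      unfolding D E norm_minus_cancel .
  qed
  show "riesz_basis_of paley_wiener_space (\<lambda>n. sinc_L2 (lam n))"
    by (rule riesz_basis_of_paley_wiener_criterion[OF subspace_paley_wiener_space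
          closed_paley_wiener_space orthonormal_basis_sinc sinc_L2_in_paley_wiener_space criterion])
qed

end
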